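(* Let $\mathcal{G}=(\mathcal{V},\mathcal{E})$ be a finite undirected graph with maximum degree $\Delta$ and $h(\gamma)=\sup_{v\in\mathcal{V}}|\partial N_v^\gamma|$, and consider an instance of networked online convex optimization on $\mathcal{G}$ satisfying Assumption (A) with constants $\mu>0$, $\ell_f,\ell_T,\ell_S<\infty$. Given any $b_1,b_2>0$, define \[ a=\sum_{\gamma\ge0}\Big(\tfrac{1+b_1}{1+b_1+b_2}\Big)^\gamma h(\gamma),\quad \tilde a=\sum_{\gamma\ge0}\Big(\tfrac{1}{1+b_1}\Big)^\gamma h(\gamma),\quad \gamma_S=\frac{\sqrt{1+\Delta\ell_S/\mu}-1}{\sqrt{1+\Delta\ell_S/\mu}+1}. \] Suppose $a,\tilde a<\infty$ and $\mu\ge\max\{8\tilde a\ell_T,\ \Delta\ell_S(b_1+b_2)/4\}$. Set \[ C_1=C_2=\max\Big\{\frac{a^2}{2\tilde a(1-4\tilde a\ell_T/\mu)},\ \frac{2a^2\Delta\ell_S/\mu}{\gamma_S(1+b_1+b_2)(1-4\tilde a\ell_T/\mu)}\Big\},\qquad \rho_T=\frac{4\tilde a\ell_T}{\mu},\qquad \rho_S=(1+b_1+b_2)\gamma_S. \] Then for every time $t$, agent $v$, integers $k,r\ge1$, every $(t_0,v_0)\in N_{(t,v)}^{(k-1,r-1)}$ and all boundary parameters $\{y_{t-1}^u\},\{(y_{t-1}^u)'\}$ ($u\in N_v^r$) and $\{z_\tau^u\},\{(z_\tau^u)'\}$ ($(\tau,u)\in\partial N_{(t,v)}^{(k,r)}$)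 in $\mathbb{R}^n$, with $x_{t_0}^{v_0}=\psi_{(t,v)}^{(k,r)}(\{y_{t-1}^u\},\{z_\tau^u\})_{(t_0,v_0)}$ and $(x_{t_0}^{v_0})'=\psi_{(t,v)}^{(k,r)}(\{(y_{t-1}^u)'\},\{(z_\tau^u)'\})_{(t_0,v_0)}$, \[ \|x_{t_0}^{v_0}-(x_{t_0}^{v_0})'\|\le C_1\!\!\sum_{(\tau,u)\in\partial N_{(t,v)}^{(k,r)}}\!\!\rho_T^{|t_0-\tau|}\rho_S^{d_{\mathcal{G}}(v_0,u)}\|z_\tau^u-(z_\tau^u)'\|+C_2\sum_{u\in N_v^r}\rho_T^{t_0-(t-1)}\rho_S^{d_{\mathcal{G}}(v_0,u)}\|y_{t-1}^u-(y_{t-1}^u)'\|. \]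
   Context: Networked online convex optimization: $\mathcal{G}=(\mathcal{V},\mathcal{E})$ is a finite undirected graph of agents, $d_{\mathcal{G}}$ its shortest-path distance, $N_v^r=\{u:d_{\mathcal{G}}(u,v)\le r\}$, $\partial N_v^r=N_v^r\setminus N_v^{r-1}$ ($N_v^{-1}=\emptyset$). For $S\subseteq\mathcal{V}$, $\mathcal{E}(S)$ is the set of edges with both endpoints in $S$ and $S_+=S\cup\{u:\exists v\in S,(u,v)\in\mathcal{E}\}$. At each time $t=1,\dots,H$ each agent $v$ picks $x_t^v\in D_t^v\subseteq\mathbb{R}^n$; $x_0$ is given. There are node costs $f_t^v:\mathbb{R}^n\to\mathbb{R}_{\ge0}$, temporal costs $c_t^v(x_t^v,x_{t-1}^v)$ with $c_t^v:\mathbb{R}^n\times\mathbb{R}^n\to\mathbb{R}_{\ge0}$, and spatial costs $s_t^e(x_t^v,x_t^u)$ for $e=(v,u)\in\mathcal{E}$ with $s_t^e:\mathbb{R}^n\times\mathbb{R}^n\to\mathbb{R}_{\ge0}$. Assumption (A): each $f_t^v$ is $\mu$-strongly convex, $\ell_f$-smooth and $C^2$; each $c_t^v$ is convex, $\ell_T$-smooth and $C^2$; each $s_t^e$ is convex, $\ell_S$-smooth and $C^2$; each $D_t^v$ has nonempty interior and equals $\{x\in\mathbb{R}^n:(g_t^v)_i(x)\le 0,\ 1\le i\le m_t^v\}$ for convex $C^2$ functions $(g_t^v)_i$. Convention: for $t>H$, $f_t^v(x)=\frac{\mu}{2}\|x\|^2$, $c_t^v\equiv s_t^e\equiv0$,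 $D_t^v=\mathbb{R}^n$. Partial costs: for $S\subseteq\mathcal{V}$, $f_t^S(x_t^{S_+})=\sum_{v\in S}f_t^v(x_t^v)+\sum_{(v,u)\in\mathcal{E}(S_+)}s_t^{(v,u)}(x_t^v,x_t^u)$ and $c_t^S(x_t^S,x_{t-1}^S)=\sum_{v\in S}c_t^v(x_t^v,x_{t-1}^v)$. Let $N_{(t,v)}^{(k,r)}=\{\tau\in\mathbb{Z}:t\le\tau<t+k\}\times N_v^r$ and $\partial N_{(t,v)}^{(k,r)}=N_{(t,v)}^{(k,r)}\setminus N_{(t,v)}^{(k-1,r-1)}$. For boundary parameters $\{y_{t-1}^u\}_{u\in N_v^r}$ and $\{z_\tau^u\}_{(\tau,u)\in\partial N_{(t,v)}^{(k,r)}}$, $\psi_{(t,v)}^{(k,r)}(\{y_{t-1}^u\},\{z_\tau^u\})$ is the optimal solution, indexed by $(\tau,u)\in N_{(t,v)}^{(k-1,r-1)}$, of: minimize $\sum_{\tau=t}^{t+k-1}\big(f_\tau^{N_v^{r-1}}(x_\tau^{N_v^r})+c_\tau^{N_v^r}(x_\tau^{N_v^r},x_{\tau-1}^{N_v^r})\big)$ subject to $x_{t-1}^u=y_{t-1}^u$ for $u\in N_v^r$, $x_\tau^u=z_\tau^u$ for $(\tau,u)\in\partial N_{(t,v)}^{(k,r)}$, and $x_\tau^u\in D_\tau^u$ for $(\tau,u)\in N_{(t,v)}^{(k-1,r-1)}$. *)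

theory Defs
  imports "HOL-Analysis.Analysis"
begin

text \<open>An undirected graph on the finite vertex set V is given by a set E of
oriented representatives: each undirected edge {v,u} occurs exactly once, as
(v,u) or as (u,v). The orientation only fixes the argument order of the
spatial cost s_t^e(x^v,x^u).\<close>

definition undirected_graph :: "'v set \<Rightarrow> ('v \<times> 'v) set \<Rightarrow> bool" where
  "undirected_graph V E \<longleftrightarrow> finite V \<and> E \<subseteq> V \<times> V \<and>
     (\<forall>v. (v, v) \<notin> E) \<and> (\<forall>u v. (u, v) \<in> E \<longrightarrow> (v, u) \<notin> E)"

definition adj :: "('v \<times> 'v) set \<Rightarrow> 'v \<Rightarrow> 'v \<Rightarrow> bool" where
  "adj E u v \<longleftrightarrow> (u, v) \<in> E \<or> (v, u) \<in> E"

definition walk :: "'v set \<Rightarrow> ('v \<times> 'v) set \<Rightarrow> nat \<Rightarrow> 'v \<Rightarrow> 'v \<Rightarrow> bool" where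
  "walk V E n u v \<longleftrightarrow> (\<exists>p :: nat \<Rightarrow> 'v. p 0 = u \<and> p n = v \<and> (\<forall>i\<le>n. p i \<in> V) \<and>
       (\<forall>i<n. adj E (p i) (p (Suc i))))"

definition gdist :: "'v set \<Rightarrow> ('v \<times> 'v) set \<Rightarrow> 'v \<Rightarrow> 'v \<Rightarrow> enat" where
  "gdist V E u v = Inf {enat n | n. walk V E n u v}"

text \<open>r-hop neighbourhood N_v^r (N_v^(-1) is handled by bdry).\<close>
definition nbhd :: "'v set \<Rightarrow> ('v \<times> 'v) set \<Rightarrow> 'v \<Rightarrow> nat \<Rightarrow> 'v set" where
  "nbhd V E v r = {u \<in> V. gdist V E u v \<le> enat r}"

definition bdry :: "'v set \<Rightarrow> ('v \<times> 'v) set \<Rightarrow> 'v \<Rightarrow> nat \<Rightarrow> 'v set" where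
  "bdry V E v r = (if r = 0 then nbhd V E v 0 else nbhd V E v r - nbhd V E v (r - 1))"

definition edges_in :: "('v \<times> 'v) set \<Rightarrow> 'v set \<Rightarrow> ('v \<times> 'v) set" where
  "edges_in E S = {(a, b) \<in> E. a \<in> S \<and> b \<in> S}"

definition splus :: "'v set \<Rightarrow> ('v \<times> 'v) set \<Rightarrow> 'v set \<Rightarrow> 'v set" where
  "splus V E S = S \<union> {u \<in> V. \<exists>w\<in>S. adj E u w}"

definition max_degree :: "'v set \<Rightarrow> ('v \<times> 'v) set \<Rightarrow> nat" where
  "max_degree V E = Max (insert 0 ((\<lambda>v. card {u \<in> V. adj E v u}) ` V))"

definition hgrowth :: "'v set \<Rightarrow> ('v \<times> 'v) set \<Rightarrow> nat \<Rightarrow> nat" where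
  "hgrowth V E \<gamma> = Max (insert 0 ((\<lambda>v. card (bdry V E v \<gamma>)) ` V))"

definition stnbhd :: "'v set \<Rightarrow> ('v \<times> 'v) set \<Rightarrow> nat \<Rightarrow> 'v \<Rightarrow> nat \<Rightarrow> nat \<Rightarrow> (nat \<times> 'v) set" where
  "stnbhd V E t v k r = {t..<t + k} \<times> nbhd V E v r"

definition stbdry :: "'v set \<Rightarrow> ('v \<times> 'v) set \<Rightarrow> nat \<Rightarrow> 'v \<Rightarrow> nat \<Rightarrow> nat \<Rightarrow> (nat \<times> 'v) set" where
  "stbdry V E t v k r = stnbhd V E t v k r - stnbhd V E t v (k - 1) (r - 1)"

definition strongly_convex :: "real \<Rightarrow> ('a::real_inner \<Rightarrow> real) \<Rightarrow> bool" where
  "strongly_convex \<mu> f \<longleftrightarrow> convex_on UNIV (\<lambda>x. f x - \<mu> / 2 * (norm x)\<^sup>2)"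

definition lsmooth :: "real \<Rightarrow> ('a::real_normed_vector \<Rightarrow> real) \<Rightarrow> bool" where
  "lsmooth l f \<longleftrightarrow> (\<exists>D :: 'a \<Rightarrow> ('a \<Rightarrow>\<^sub>L real).
      (\<forall>x. (f has_derivative blinfun_apply (D x)) (at x)) \<and>
      (\<forall>x y. norm (D x - D y) \<le> l * norm (x - y)))"

definition C2 :: "('a::real_normed_vector \<Rightarrow> real) \<Rightarrow> bool" where
  "C2 f \<longleftrightarrow> (\<exists>(D :: 'a \<Rightarrow> ('a \<Rightarrow>\<^sub>L real)) (D2 :: 'a \<Rightarrow> ('a \<Rightarrow>\<^sub>L ('a \<Rightarrow>\<^sub>L real))).
      (\<forall>x. (f has_derivative blinfun_apply (D x)) (at x)) \<and>
      (\<forall>x. (D has_derivative blinfun_apply (D2 x)) (at x)) \<and>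
      continuous_on UNIV D2)"

definition fe :: "nat \<Rightarrow> real \<Rightarrow> (nat \<Rightarrow> 'v \<Rightarrow> 'a::real_normed_vector \<Rightarrow> real) \<Rightarrow> nat \<Rightarrow> 'v \<Rightarrow> 'a \<Rightarrow> real" where
  "fe H \<mu> f t v x = (if t \<le> H then f t v x else \<mu> / 2 * (norm x)\<^sup>2)"

definition ce :: "nat \<Rightarrow> (nat \<Rightarrow> 'v \<Rightarrow> 'a \<Rightarrow> 'a \<Rightarrow> real) \<Rightarrow> nat \<Rightarrow> 'v \<Rightarrow> 'a \<Rightarrow> 'a \<Rightarrow> real" where
  "ce H c t v x y = (if t \<le> H then c t v x y else 0)"

definition se :: "nat \<Rightarrow> (nat \<Rightarrow> ('v \<times> 'v) \<Rightarrow> 'a \<Rightarrow> 'a \<Rightarrow> real) \<Rightarrow> nat \<Rightarrow> ('v \<times> 'v) \<Rightarrow> 'a \<Rightarrow> 'a \<Rightarrow> real" where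
  "se H s t e x y = (if t \<le> H then s t e x y else 0)"

definition Dom :: "nat \<Rightarrow> (nat \<Rightarrow> 'v \<Rightarrow> nat \<Rightarrow> 'a \<Rightarrow> real) \<Rightarrow> (nat \<Rightarrow> 'v \<Rightarrow> nat) \<Rightarrow> nat \<Rightarrow> 'v \<Rightarrow> 'a set" where
  "Dom H g m t v = (if t \<le> H then {x. \<forall>i\<in>{1..m t v}. g t v i x \<le> 0} else UNIV)"

definition assumption_A ::
  "'v set \<Rightarrow> ('v \<times> 'v) set \<Rightarrow> nat \<Rightarrow> real \<Rightarrow> real \<Rightarrow> real \<Rightarrow> real \<Rightarrow>
   (nat \<Rightarrow> 'v \<Rightarrow> 'a::euclidean_space \<Rightarrow> real) \<Rightarrow> (nat \<Rightarrow> 'v \<Rightarrow> 'a \<Rightarrow> 'a \<Rightarrow> real) \<Rightarrow>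
   (nat \<Rightarrow> ('v \<times> 'v) \<Rightarrow> 'a \<Rightarrow> 'a \<Rightarrow> real) \<Rightarrow>
   (nat \<Rightarrow> 'v \<Rightarrow> nat \<Rightarrow> 'a \<Rightarrow> real) \<Rightarrow> (nat \<Rightarrow> 'v \<Rightarrow> nat) \<Rightarrow> bool" where
  "assumption_A V E H \<mu> lf lT lS f c s g m \<longleftrightarrow>
     (\<forall>t\<in>{1..H}. \<forall>v\<in>V.
        (\<forall>x. 0 \<le> f t v x) \<and> strongly_convex \<mu> (f t v) \<and> lsmooth lf (f t v) \<and> C2 (f t v) \<and>
        (\<forall>x y. 0 \<le> c t v x y) \<and> convex_on UNIV (case_prod (c t v)) \<and>
        lsmooth lT (case_prod (c t v)) \<and> C2 (case_prod (c t v)) \<and>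
        interior (Dom H g m t v) \<noteq> {} \<and>
        (\<forall>i\<in>{1..m t v}. convex_on UNIV (g t v i) \<and> C2 (g t v i))) \<and>
     (\<forall>t\<in>{1..H}. \<forall>e\<in>E.
        (\<forall>x y. 0 \<le> s t e x y) \<and> convex_on UNIV (case_prod (s t e)) \<and>
        lsmooth lS (case_prod (s t e)) \<and> C2 (case_prod (s t e)))"

definition assemble :: "'v set \<Rightarrow> ('v \<times> 'v) set \<Rightarrow> nat \<Rightarrow> 'v \<Rightarrow> nat \<Rightarrow> nat \<Rightarrow>
    ('v \<Rightarrow> 'a) \<Rightarrow> (nat \<Rightarrow> 'v \<Rightarrow> 'a) \<Rightarrow> (nat \<Rightarrow> 'v \<Rightarrow> 'a) \<Rightarrow> nat \<Rightarrow> 'v \<Rightarrow> 'a" where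
  "assemble V E t v k r y z w \<tau> u =
     (if \<tau> = t - 1 \<and> u \<in> nbhd V E v r then y u
      else if (\<tau>, u) \<in> stbdry V E t v k r then z \<tau> u else w \<tau> u)"

definition local_obj :: "'v set \<Rightarrow> ('v \<times> 'v) set \<Rightarrow> nat \<Rightarrow> real \<Rightarrow>
    (nat \<Rightarrow> 'v \<Rightarrow> 'a::real_normed_vector \<Rightarrow> real) \<Rightarrow> (nat \<Rightarrow> 'v \<Rightarrow> 'a \<Rightarrow> 'a \<Rightarrow> real) \<Rightarrow>
    (nat \<Rightarrow> ('v \<times> 'v) \<Rightarrow> 'a \<Rightarrow> 'a \<Rightarrow> real) \<Rightarrow>
    nat \<Rightarrow> 'v \<Rightarrow> nat \<Rightarrow> nat \<Rightarrow> (nat \<Rightarrow> 'v \<Rightarrow> 'a) \<Rightarrow> real" where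
  "local_obj V E H \<mu> f c s t v k r x =
     (\<Sum>\<tau>\<in>{t..<t + k}.
        (\<Sum>u\<in>nbhd V E v (r - 1). fe H \<mu> f \<tau> u (x \<tau> u))
      + (\<Sum>e\<in>edges_in E (splus V E (nbhd V E v (r - 1))). se H s \<tau> e (x \<tau> (fst e)) (x \<tau> (snd e)))
      + (\<Sum>u\<in>nbhd V E v r. ce H c \<tau> u (x \<tau> u) (x (\<tau> - 1) u)))"

text \<open>Feasible free parts: values in D on N_(t,v)^(k-1,r-1), and (normalisation,
irrelevant for the problem) zero outside it.\<close>
definition local_feasible :: "'v set \<Rightarrow> ('v \<times> 'v) set \<Rightarrow> nat \<Rightarrow>
    (nat \<Rightarrow> 'v \<Rightarrow> nat \<Rightarrow> 'a::real_normed_vector \<Rightarrow> real) \<Rightarrow> (nat \<Rightarrow> 'v \<Rightarrow> nat) \<Rightarrow>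
    nat \<Rightarrow> 'v \<Rightarrow> nat \<Rightarrow> nat \<Rightarrow> (nat \<Rightarrow> 'v \<Rightarrow> 'a) \<Rightarrow> bool" where
  "local_feasible V E H g m t v k r w \<longleftrightarrow>
     (\<forall>\<tau> u. (\<tau>, u) \<in> stnbhd V E t v (k - 1) (r - 1) \<longrightarrow> w \<tau> u \<in> Dom H g m \<tau> u) \<and>
     (\<forall>\<tau> u. (\<tau>, u) \<notin> stnbhd V E t v (k - 1) (r - 1) \<longrightarrow> w \<tau> u = 0)"

definition psi :: "'v set \<Rightarrow> ('v \<times> 'v) set \<Rightarrow> nat \<Rightarrow> real \<Rightarrow>
    (nat \<Rightarrow> 'v \<Rightarrow> 'a::real_normed_vector \<Rightarrow> real) \<Rightarrow> (nat \<Rightarrow> 'v \<Rightarrow> 'a \<Rightarrow> 'a \<Rightarrow> real) \<Rightarrow>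
    (nat \<Rightarrow> ('v \<times> 'v) \<Rightarrow> 'a \<Rightarrow> 'a \<Rightarrow> real) \<Rightarrow>
    (nat \<Rightarrow> 'v \<Rightarrow> nat \<Rightarrow> 'a \<Rightarrow> real) \<Rightarrow> (nat \<Rightarrow> 'v \<Rightarrow> nat) \<Rightarrow>
    nat \<Rightarrow> 'v \<Rightarrow> nat \<Rightarrow> nat \<Rightarrow> ('v \<Rightarrow> 'a) \<Rightarrow> (nat \<Rightarrow> 'v \<Rightarrow> 'a) \<Rightarrow> nat \<Rightarrow> 'v \<Rightarrow> 'a" where
  "psi V E H \<mu> f c s g m t v k r y z =
     (THE w. local_feasible V E H g m t v k r w \<and>
        (\<forall>w'. local_feasible V E H g m t v k r w' \<longrightarrow>
           local_obj V E H \<mu> f c s t v k r (assemble V E t v k r y z w)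
             \<le> local_obj V E H \<mu> f c s t v k r (assemble V E t v k r y z w')))"


definition Delta :: "'v set \<Rightarrow> ('v \<times> 'v) set \<Rightarrow> real" where
  "Delta V E = real (max_degree V E)"

definition const_a :: "'v set \<Rightarrow> ('v \<times> 'v) set \<Rightarrow> real \<Rightarrow> real \<Rightarrow> real" where
  "const_a V E b1 b2 = (\<Sum>\<gamma>. ((1 + b1) / (1 + b1 + b2)) ^ \<gamma> * real (hgrowth V E \<gamma>))"

definition const_atil :: "'v set \<Rightarrow> ('v \<times> 'v) set \<Rightarrow> real \<Rightarrow> real" where
  "const_atil V E b1 = (\<Sum>\<gamma>. (1 / (1 + b1)) ^ \<gamma> * real (hgrowth V E \<gamma>))"

definition gammaS :: "'v set \<Rightarrow> ('v \<times> 'v) set \<Rightarrow> real \<Rightarrow> real \<Rightarrow> real" where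
  "gammaS V E \<mu> lS = (sqrt (1 + Delta V E * lS / \<mu>) - 1) / (sqrt (1 + Delta V E * lS / \<mu>) + 1)"

definition const_C :: "'v set \<Rightarrow> ('v \<times> 'v) set \<Rightarrow> real \<Rightarrow> real \<Rightarrow> real \<Rightarrow> real \<Rightarrow> real \<Rightarrow> real" where
  "const_C V E \<mu> lT lS b1 b2 =
     max ((const_a V E b1 b2)\<^sup>2 / (2 * const_atil V E b1 * (1 - 4 * const_atil V E b1 * lT / \<mu>)))
         (2 * (const_a V E b1 b2)\<^sup>2 * Delta V E * lS / \<mu> /
            (gammaS V E \<mu> lS * (1 + b1 + b2) * (1 - 4 * const_atil V E b1 * lT / \<mu>)))"

definition rhoT :: "'v set \<Rightarrow> ('v \<times> 'v) set \<Rightarrow> real \<Rightarrow> real \<Rightarrow> real \<Rightarrow> real" where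
  "rhoT V E \<mu> lT b1 = 4 * const_atil V E b1 * lT / \<mu>"

definition rhoS :: "'v set \<Rightarrow> ('v \<times> 'v) set \<Rightarrow> real \<Rightarrow> real \<Rightarrow> real \<Rightarrow> real \<Rightarrow> real" where
  "rhoS V E \<mu> lS b1 b2 = (1 + b1 + b2) * gammaS V E \<mu> lS"

end

theory Submission
  imports Defs
begin

text \<open>Let \<open>\<delta>\<close> be the difference of the two optimal solutions and \<open>\<theta>\<close> nonnegative weights vanishing
  on the fixed nodes. Testing the variational inequality of each minimizer in the feasible direction
  \<open>\<plusminus>\<theta>\<^sup>2 \<delta>\<close> gives, without any second derivatives or multipliers,
  \<open>\<mu> \<Sum> \<theta>\<^sub>i\<^sup>2 |\<delta>\<^sub>i|\<^sup>2 \<le> \<Sum> (\<ell> / 2) (\<theta>\<^sub>i - \<theta>\<^sub>j)\<^sup>2 |\<delta>\<^sub>i| |\<delta>\<^sub>j|\<close>, the right-hand sum running over the coupling terms: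
  a convex \<open>\<ell>\<close>-smooth coupling can only hurt through the variation of the weights. With the
  Combes--Thomas weights \<open>\<rho>\<^sub>T ^ |t\<^sub>0 - \<tau>| * x ^ d(v\<^sub>0, u)\<close> the couplings among free nodes consume only part
  of the strong convexity, and the couplings of a free to a fixed node give the right-hand side of the claim.
  Here \<open>x\<close> is \<open>\<rho>\<^sub>S\<close> increased by the factor \<open>1 + 1 / D\<close>, where \<open>D\<close> is the largest finite distance.\<close>

subsection \<open>Gradients of smooth convex functions\<close>

text \<open>The domains constrain each node separately, so a direction may be scaled by a different
  factor at every node and stay feasible; this is what admits \<open>\<theta>\<^sup>2\<close>. The
  strong convexity \<mu> is a budget. At the rate \<open>gammaS\<close> the spatial couplings use
  all of it; raising the rate by the factor 1 + b1 + b2 cuts their share to at most 1 / (1 + b1 +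
  b2), and the temporal couplings are allotted 1 / (8 \<open>const_atil\<close>). The obstacle is
  the remainder: for b1, b2 small against 1 / D it can be negative, while the final constant offers
  only the factor \<open>const_a\<close> squared to pay for a small one. The extra factor 1 + 1 / D
  in the rate restores a remainder of the right order. The link to the two series is that a shortest
  walk of length D meets every smaller distance, so \<open>hgrowth\<close> is at least 1 up to D and
  both series dominate geometric sums of D + 1 terms. A coupling to a fixed node is only linear in
  the weighted norm of \<delta>, so one power of that norm cancels; the norm controls the target
  because the weight at \<open>(t0, v0)\<close> is 1.\<close>

lemma GDERIV_along_line:
  assumes "GDERIV f (x + t *\<^sub>R d) :> G"
  shows "((\<lambda>t. f (x + t *\<^sub>R d)) has_real_derivative d \<bullet> G) (at t)"
proof -
  have "((\<lambda>t. x + t *\<^sub>R d) has_derivative (\<lambda>h. h *\<^sub>R d)) (at t)"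
    by (auto intro!: derivative_eq_intros)
  from has_derivative_compose[OF this assms[unfolded gderiv_def]]
  show ?thesis
    by (rule has_derivative_imp_has_field_derivative) (simp add: mult.commute)
qed

lemma has_derivative_imp_GDERIV:
  fixes f :: "'a::euclidean_space \<Rightarrow> real"
  assumes "(f has_derivative D) (at x)"
  shows "GDERIV f x :> (\<Sum>b\<in>Basis. D b *\<^sub>R b)"
proof -
  interpret D: bounded_linear D
    using assms by (rule has_derivative_bounded_linear)
  have "D h = h \<bullet> (\<Sum>b\<in>Basis. D b *\<^sub>R b)" for h
  proof -
    have "D h = D (\<Sum>b\<in>Basis. (h \<bullet> b) *\<^sub>R b)"
      by (simp add: euclidean_representation)
    also have "\<dots> = (\<Sum>b\<in>Basis. (h \<bullet> b) * D b)"
      by (simp add: D.sum D.scaleR)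
    finally show ?thesis
      by (simp add: inner_sum_right mult.commute)
  qed
  then have "D = (\<lambda>h. h \<bullet> (\<Sum>b\<in>Basis. D b *\<^sub>R b))" by (rule ext)
  then show ?thesis
    using assms unfolding gderiv_def by simp
qed

text \<open>Testing the functional \<open>D x - D y\<close> on the vector that represents it bounds
  the norm of that vector by the operator norm, which carries the Lipschitz bound from derivatives
  to gradients.\<close>

lemma lsmooth_gradient:
  fixes f :: "'a::euclidean_space \<Rightarrow> real"
  assumes "lsmooth l f"
  obtains G where "\<And>x. GDERIV f x :> G x" "\<And>x y. norm (G x - G y) \<le> l * norm (x - y)"
proof -
  obtain D :: "'a \<Rightarrow> 'a \<Rightarrow>\<^sub>L real" where D: "\<And>x. (f has_derivative blinfun_apply (D x)) (at x)"
    and lip: "\<And>x y. norm (D x - D y) \<le> l * norm (x - y)"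
    using assms unfolding lsmooth_def by blast
  define G where "G x = (\<Sum>b\<in>Basis. D x b *\<^sub>R b)" for x
  have G: "GDERIV f x :> G x" for x
    unfolding G_def by (rule has_derivative_imp_GDERIV[OF D])
  have app: "D x h = h \<bullet> G x" for x h
    using fun_cong[OF has_derivative_unique[OF D G[unfolded gderiv_def]]] .
  have "norm (G x - G y) \<le> l * norm (x - y)" for x y
  proof -
    let ?g = "G x - G y"
    have "norm ?g * norm ?g = (D x - D y) ?g"
      by (simp add: blinfun.diff_left app inner_diff_right[symmetric] power2_norm_eq_inner[symmetric] power2_eq_square)
    also have "\<dots> \<le> norm (D x - D y) * norm ?g"
      using norm_blinfun[of "D x - D y" ?g] by simp
    finally have "norm ?g \<le> norm (D x - D y)"
      using mult_right_le_imp_le[of "norm ?g" "norm ?g"] by (cases "norm ?g = 0") auto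
    with lip[of x y] show ?thesis by simp
  qed
  with G that show ?thesis by blast
qed

lemma convex_on_above_tangent_GDERIV:
  assumes "convex_on UNIV f" "GDERIV f x :> G"
  shows "f x + (y - x) \<bullet> G \<le> f y"
proof -
  let ?\<phi> = "\<lambda>t::real. f (x + t *\<^sub>R (y - x))"
  have "convex_on UNIV ?\<phi>"
  proof (rule convex_onI)
    fix t a b :: real
    assume "0 < t" "t < 1"
    then have "f ((1 - t) *\<^sub>R (x + a *\<^sub>R (y - x)) + t *\<^sub>R (x + b *\<^sub>R (y - x))) \<le> (1 - t) * ?\<phi> a + t * ?\<phi> b"
      by (intro convex_onD[OF assms(1)]) auto
    then show "?\<phi> ((1 - t) *\<^sub>R a + t *\<^sub>R b) \<le> (1 - t) * ?\<phi> a + t * ?\<phi> b"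
      by (simp add: algebra_simps)
  qed simp
  moreover have "(?\<phi> has_real_derivative (y - x) \<bullet> G) (at 0)"
    using GDERIV_along_line[of f x 0 "y - x" G] assms(2) by simp
  ultimately have "?\<phi> 1 - ?\<phi> 0 \<ge> ((y - x) \<bullet> G) * (1 - 0)"
    by (intro convex_on_imp_above_tangent[where A = UNIV]) auto
  then show ?thesis by simp
qed

lemma strongly_convex_gradient_monotone:
  assumes "strongly_convex \<mu> f" "GDERIV f x :> G" "GDERIV f y :> G'"
  shows "\<mu> * (norm (x - y))\<^sup>2 \<le> (x - y) \<bullet> (G - G')"
proof -
  let ?h = "\<lambda>x. f x - \<mu> / 2 * (norm x)\<^sup>2"
  have cvx: "convex_on UNIV ?h" using assms(1) by (simp add: strongly_convex_def)
  have sq: "GDERIV (\<lambda>x. \<mu> / 2 * (norm x)\<^sup>2) x :> \<mu> *\<^sub>R x" for x :: 'a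
    unfolding gderiv_def power2_norm_eq_inner
    by (auto intro!: derivative_eq_intros simp: inner_commute)
  have "?h x + (y - x) \<bullet> (G - \<mu> *\<^sub>R x) \<le> ?h y"
    by (rule convex_on_above_tangent_GDERIV[OF cvx GDERIV_diff[OF assms(2) sq]])
  moreover have "?h y + (x - y) \<bullet> (G' - \<mu> *\<^sub>R y) \<le> ?h x"
    by (rule convex_on_above_tangent_GDERIV[OF cvx GDERIV_diff[OF assms(3) sq]])
  ultimately show ?thesis
    by (simp add: power2_norm_eq_inner inner_diff_left inner_diff_right inner_commute algebra_simps)
qed

lemma descent_lemma:
  assumes G: "\<And>x. GDERIV f x :> G x" and lip: "\<And>x y. norm (G x - G y) \<le> l * norm (x - y)"
  shows "f (x + d) \<le> f x + d \<bullet> G x + l / 2 * (norm d)\<^sup>2"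
proof -
  let ?\<phi> = "\<lambda>t. f x + t * (d \<bullet> G x) + l / 2 * t\<^sup>2 * (norm d)\<^sup>2 - f (x + t *\<^sub>R d)"
  have "?\<phi> 0 \<le> ?\<phi> 1"
  proof (rule DERIV_nonneg_imp_nondecreasing[where f = ?\<phi>])
    fix t :: real assume t: "0 \<le> t" "t \<le> 1"
    have "(?\<phi> has_real_derivative d \<bullet> G x + l * t * (norm d)\<^sup>2 - d \<bullet> G (x + t *\<^sub>R d)) (at t)"
      by (auto intro!: derivative_eq_intros GDERIV_along_line G)
    moreover have "d \<bullet> (G (x + t *\<^sub>R d) - G x) \<le> norm d * (l * norm (t *\<^sub>R d))"
      using lip[of "x + t *\<^sub>R d" x]
      by (intro order.trans[OF norm_cauchy_schwarz] mult_left_mono) auto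
    then have "0 \<le> d \<bullet> G x + l * t * (norm d)\<^sup>2 - d \<bullet> G (x + t *\<^sub>R d)"
      using t by (simp add: inner_diff_right power2_eq_square algebra_simps)
    ultimately show "\<exists>y. (?\<phi> has_real_derivative y) (at t) \<and> 0 \<le> y" by blast
  qed simp
  then show ?thesis by simp
qed

text \<open>Baillon--Haddad: the tangent inequality at \<open>x\<close>, evaluated at a gradient step from \<open>y\<close>, is
  combined with the descent lemma at \<open>y\<close>.\<close>
lemma smooth_convex_cocoercive:
  assumes cvx: "convex_on UNIV f" and G: "\<And>x. GDERIV f x :> G x"
    and lip: "\<And>x y. norm (G x - G y) \<le> l * norm (x - y)" and l: "0 \<le> l"
  shows "(norm (G x - G y))\<^sup>2 \<le> l * ((x - y) \<bullet> (G x - G y))"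
proof (cases "l = 0")
  case True
  then show ?thesis using lip[of x y] by simp
next
  case False
  with l have l: "0 < l" by simp
  have half: "f x + (y - x) \<bullet> G x + (norm (G y - G x))\<^sup>2 / (2 * l) \<le> f y" for x y
  proof -
    define e where "e = G y - G x"
    \<comment> \<open>This step minimizes the bound
      \<open>d \<bullet> e + l / 2 * (norm d)\<^sup>2\<close> of the descent lemma; the gain is the
      square term of the claim.\<close>
    define d where "d = - (1 / l) *\<^sub>R e"
    have "f x + (y + d - x) \<bullet> G x \<le> f (y + d)"
      by (rule convex_on_above_tangent_GDERIV[OF cvx G])
    also have "\<dots> \<le> f y + d \<bullet> G y + l / 2 * (norm d)\<^sup>2"
      by (rule descent_lemma[OF G lip])
    finally have "f x + (y - x) \<bullet> G x \<le> f y + d \<bullet> e + l / 2 * (norm d)\<^sup>2"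
      by (simp add: e_def inner_simps)
    moreover have "d \<bullet> e = - (norm e)\<^sup>2 / l"
      by (simp add: d_def power2_norm_eq_inner)
    moreover have "l / 2 * (norm d)\<^sup>2 = (norm e)\<^sup>2 / (2 * l)"
      using l by (simp add: d_def power_mult_distrib power_divide power2_eq_square[of l])
    moreover have "(norm e)\<^sup>2 / l = 2 * ((norm e)\<^sup>2 / (2 * l))"
      using l by simp
    ultimately show ?thesis unfolding e_def[symmetric] by linarith
  qed
  have "(norm (G x - G y))\<^sup>2 / l \<le> (x - y) \<bullet> (G x - G y)"
    using half[of x y] half[of y x] l
    by (simp add: norm_minus_commute inner_simps field_simps)
  then show ?thesis using l by (simp add: field_simps)
qed

text \<open>If \<open>(G, G') = M (a, b)\<close> with \<open>0 \<le> M \<le> l\<close> symmetric then the off-diagonal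
  block of \<open>M\<close> has norm at most \<open>l/2\<close>; this is the estimate that follows, with \<open>M\<close> replaced
  by co-coercivity.\<close>
lemma weighted_cocoercive:
  fixes a b G G' :: "'a::real_inner" and \<alpha> \<beta> l :: real
  assumes coco: "(norm G)\<^sup>2 + (norm G')\<^sup>2 \<le> l * (a \<bullet> G + b \<bullet> G')" and l: "0 \<le> l"
  shows "- (l / 2 * (\<alpha> - \<beta>)\<^sup>2 * norm a * norm b) \<le> \<alpha>\<^sup>2 * (a \<bullet> G) + \<beta>\<^sup>2 * (b \<bullet> G')"
proof -
  \<comment> \<open>If \<open>0 \<le> M \<le> l\<close>, then \<open>2 M - l\<close> has norm at
    most \<open>l\<close>; \<open>u\<close> and \<open>w\<close> are its components on
    \<open>(a, b)\<close>, and \<open>uw\<close> is co-coercivity after completing the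
    square.\<close>
  define u w where "u = 2 *\<^sub>R G - l *\<^sub>R a" and "w = 2 *\<^sub>R G' - l *\<^sub>R b"
  define A B where "A = norm a" and "B = norm b"
  let ?X = "\<alpha>\<^sup>2 * (norm u * A) + \<beta>\<^sup>2 * (norm w * B)"
  let ?Y = "\<alpha>\<^sup>2 * A\<^sup>2 + \<beta>\<^sup>2 * B\<^sup>2 + (\<alpha> - \<beta>)\<^sup>2 * A * B"
  have AB: "0 \<le> A" "0 \<le> B" by (simp_all add: A_def B_def)
  have uw: "(norm u)\<^sup>2 + (norm w)\<^sup>2 \<le> l\<^sup>2 * (A\<^sup>2 + B\<^sup>2)"
    using coco by (simp add: u_def w_def A_def B_def power2_norm_eq_inner inner_simps inner_commute
        power2_eq_square[of l] algebra_simps)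
  have "?X\<^sup>2 \<le> ((norm u)\<^sup>2 + (norm w)\<^sup>2) * ((\<alpha>\<^sup>2 * A)\<^sup>2 + (\<beta>\<^sup>2 * B)\<^sup>2)"
  proof -
    have "((norm u)\<^sup>2 + (norm w)\<^sup>2) * ((\<alpha>\<^sup>2 * A)\<^sup>2 + (\<beta>\<^sup>2 * B)\<^sup>2) - ?X\<^sup>2
        = (norm u * (\<beta>\<^sup>2 * B) - norm w * (\<alpha>\<^sup>2 * A))\<^sup>2"
      by (simp add: power2_eq_square algebra_simps)
    then show ?thesis using zero_le_power2[of "norm u * (\<beta>\<^sup>2 * B) - norm w * (\<alpha>\<^sup>2 * A)"] by linarith
  qed
  also have "\<dots> \<le> (l\<^sup>2 * (A\<^sup>2 + B\<^sup>2)) * ((\<alpha>\<^sup>2 * A)\<^sup>2 + (\<beta>\<^sup>2 * B)\<^sup>2)"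
    by (intro mult_right_mono uw) auto
  also have "\<dots> = l\<^sup>2 * ((A\<^sup>2 + B\<^sup>2) * ((\<alpha>\<^sup>2 * A)\<^sup>2 + (\<beta>\<^sup>2 * B)\<^sup>2))"
    by simp
  \<comment> \<open>The coefficient \<open>(\<alpha> - \<beta>)\<^sup>2\<close> in \<open>?Y\<close>
    is what turns the difference of both sides into a nonnegative multiple of a square, with
    equality when \<open>\<alpha> * A = \<beta> * B\<close>.\<close>
  also have "\<dots> \<le> l\<^sup>2 * ?Y\<^sup>2"
  proof (rule mult_left_mono)
    have "?Y\<^sup>2 - (A\<^sup>2 + B\<^sup>2) * ((\<alpha>\<^sup>2 * A)\<^sup>2 + (\<beta>\<^sup>2 * B)\<^sup>2)
        = (\<alpha> - \<beta>)\<^sup>2 * A * B * (2 * (\<alpha> * A - \<beta> * B)\<^sup>2)"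
      by (simp add: power2_eq_square algebra_simps)
    moreover have "0 \<le> \<dots>" using AB by simp
    ultimately show "(A\<^sup>2 + B\<^sup>2) * ((\<alpha>\<^sup>2 * A)\<^sup>2 + (\<beta>\<^sup>2 * B)\<^sup>2) \<le> ?Y\<^sup>2" by linarith
  qed simp
  finally have "?X\<^sup>2 \<le> (l * ?Y)\<^sup>2" by (simp add: power_mult_distrib)
  moreover have "0 \<le> l * ?Y" using AB l by simp
  ultimately have XY: "?X \<le> l * ?Y" by (rule power2_le_imp_le)
  have "- (\<alpha>\<^sup>2 * (norm u * A)) \<le> \<alpha>\<^sup>2 * (a \<bullet> u)" "- (\<beta>\<^sup>2 * (norm w * B)) \<le> \<beta>\<^sup>2 * (b \<bullet> w)"
    using mult_left_mono[of "- (norm a * norm u)" "a \<bullet> u" "\<alpha>\<^sup>2"] Cauchy_Schwarz_ineq2[of a u]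
      mult_left_mono[of "- (norm b * norm w)" "b \<bullet> w" "\<beta>\<^sup>2"] Cauchy_Schwarz_ineq2[of b w]
    by (auto simp: A_def B_def abs_le_iff mult.commute)
  with XY have "- (l * ?Y) \<le> \<alpha>\<^sup>2 * (a \<bullet> u) + \<beta>\<^sup>2 * (b \<bullet> w)" by linarith
  also have "\<dots> = 2 * (\<alpha>\<^sup>2 * (a \<bullet> G) + \<beta>\<^sup>2 * (b \<bullet> G')) - l * (\<alpha>\<^sup>2 * A\<^sup>2 + \<beta>\<^sup>2 * B\<^sup>2)"
    by (simp add: u_def w_def A_def B_def inner_simps power2_norm_eq_inner algebra_simps)
  finally show ?thesis
    by (simp add: A_def B_def algebra_simps)
qed

subsection \<open>Strongly convex problems with pairwise coupling\<close>

lemma strongly_convex_midpoint: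
  assumes "strongly_convex \<mu> f"
  shows "f ((1 / 2) *\<^sub>R (x + y)) \<le> (f x + f y) / 2 - \<mu> / 8 * (norm (x - y))\<^sup>2"
proof -
  let ?h = "\<lambda>x. f x - \<mu> / 2 * (norm x)\<^sup>2"
  have "?h ((1 - 1 / 2) *\<^sub>R x + (1 / 2) *\<^sub>R y) \<le> (1 - 1 / 2) * ?h x + (1 / 2) * ?h y"
    using assms unfolding strongly_convex_def by (intro convex_onD) auto
  moreover have "(norm ((1 / 2) *\<^sub>R (x + y)))\<^sup>2 + (norm (x - y))\<^sup>2 / 4 = ((norm x)\<^sup>2 + (norm y)\<^sup>2) / 2"
    by (simp add: power2_norm_eq_inner inner_simps inner_commute field_simps)
  then have "\<mu> / 2 * ((norm ((1 / 2) *\<^sub>R (x + y)))\<^sup>2 + (norm (x - y))\<^sup>2 / 4)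
      = \<mu> / 2 * (((norm x)\<^sup>2 + (norm y)\<^sup>2) / 2)"
    by (rule arg_cong)
  ultimately show ?thesis
    by (simp add: scaleR_add_right algebra_simps add_divide_distrib)
qed

text \<open>The local problem without its space-time structure: \<open>M\<close> indexes node costs,
  \<open>N\<close> the free nodes, \<open>P\<close> the couplings. Letting \<open>M\<close> exceed
  \<open>N\<close> keeps costs of fixed nodes in the objective as constants; the ends of a coupling
  may lie outside \<open>M\<close>.\<close>

locale pairwise_problem =
  fixes M N :: "'i set" and P :: "'p set" and src dst :: "'p \<Rightarrow> 'i"
    and f :: "'i \<Rightarrow> 'a::euclidean_space \<Rightarrow> real" and q :: "'p \<Rightarrow> 'a \<times> 'a \<Rightarrow> real"
    and l :: "'p \<Rightarrow> real" and K :: "'i \<Rightarrow> 'a set" and \<mu> :: real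
  assumes finite_M: "finite M" and N_subset: "N \<subseteq> M" and finite_P: "finite P"
    and mu_pos: "0 < \<mu>"
    and f_nonneg: "\<And>i x. i \<in> M \<Longrightarrow> 0 \<le> f i x"
    and f_strongly_convex: "\<And>i. i \<in> M \<Longrightarrow> strongly_convex \<mu> (f i)"
    and f_differentiable: "\<And>i x. i \<in> M \<Longrightarrow> f i differentiable (at x)"
    and q_nonneg: "\<And>p x. p \<in> P \<Longrightarrow> 0 \<le> q p x"
    and q_convex: "\<And>p. p \<in> P \<Longrightarrow> convex_on UNIV (q p)"
    and q_smooth: "\<And>p. p \<in> P \<Longrightarrow> lsmooth (l p) (q p)"
    and l_nonneg: "\<And>p. p \<in> P \<Longrightarrow> 0 \<le> l p"
    and K_closed: "\<And>i. i \<in> N \<Longrightarrow> closed (K i)"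
    and K_convex: "\<And>i. i \<in> N \<Longrightarrow> convex (K i)"
    and K_nonempty: "\<And>i. i \<in> N \<Longrightarrow> K i \<noteq> {}"
begin

definition F :: "('i \<Rightarrow> 'a) \<Rightarrow> real" where
  "F x = (\<Sum>i\<in>M. f i (x i)) + (\<Sum>p\<in>P. q p (x (src p), x (dst p)))"

definition feasible :: "('i \<Rightarrow> 'a) \<Rightarrow> ('i \<Rightarrow> 'a) \<Rightarrow> bool" where
  "feasible b x \<longleftrightarrow> (\<forall>i\<in>N. x i \<in> K i) \<and> (\<forall>i. i \<notin> N \<longrightarrow> x i = b i)"

definition minimizer :: "('i \<Rightarrow> 'a) \<Rightarrow> ('i \<Rightarrow> 'a) \<Rightarrow> bool" where
  "minimizer b x \<longleftrightarrow> feasible b x \<and> (\<forall>x'. feasible b x' \<longrightarrow> F x \<le> F x')"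

section \<open>Existence and uniqueness of minimizers\<close>

lemma finite_N: "finite N"
  using N_subset finite_M by (rule finite_subset)

lemma F_nonneg: "0 \<le> F x"
  unfolding F_def by (intro add_nonneg_nonneg sum_nonneg f_nonneg q_nonneg)

text \<open>The quadratic gain comes from the node costs alone, the couplings being merely convex.
  Both uniqueness and existence of minimizers rest on this inequality.\<close>

lemma F_midpoint:
  "F (\<lambda>i. (1 / 2) *\<^sub>R (x i + y i)) \<le> (F x + F y) / 2 - \<mu> / 8 * (\<Sum>i\<in>N. (norm (x i - y i))\<^sup>2)"
proof -
  have "(\<Sum>i\<in>M. f i ((1 / 2) *\<^sub>R (x i + y i)))
      \<le> (\<Sum>i\<in>M. (f i (x i) + f i (y i)) / 2 - \<mu> / 8 * (norm (x i - y i))\<^sup>2)"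
    by (intro sum_mono strongly_convex_midpoint f_strongly_convex)
  also have "\<dots> = ((\<Sum>i\<in>M. f i (x i)) + (\<Sum>i\<in>M. f i (y i))) / 2
      - \<mu> / 8 * (\<Sum>i\<in>M. (norm (x i - y i))\<^sup>2)"
    by (simp add: sum_subtractf sum_divide_distrib[symmetric] sum.distrib sum_distrib_left)
  finally have f: "(\<Sum>i\<in>M. f i ((1 / 2) *\<^sub>R (x i + y i)))
      \<le> ((\<Sum>i\<in>M. f i (x i)) + (\<Sum>i\<in>M. f i (y i))) / 2 - \<mu> / 8 * (\<Sum>i\<in>M. (norm (x i - y i))\<^sup>2)" .
  have "(\<Sum>i\<in>N. (norm (x i - y i))\<^sup>2) \<le> (\<Sum>i\<in>M. (norm (x i - y i))\<^sup>2)"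
    by (rule sum_mono2[OF finite_M N_subset]) auto
  then have NM: "\<mu> / 8 * (\<Sum>i\<in>N. (norm (x i - y i))\<^sup>2) \<le> \<mu> / 8 * (\<Sum>i\<in>M. (norm (x i - y i))\<^sup>2)"
    using mu_pos by (intro mult_left_mono) auto
  have "(\<Sum>p\<in>P. q p ((1 / 2) *\<^sub>R (x (src p) + y (src p)), (1 / 2) *\<^sub>R (x (dst p) + y (dst p))))
      \<le> (\<Sum>p\<in>P. (q p (x (src p), x (dst p)) + q p (y (src p), y (dst p))) / 2)"
  proof (rule sum_mono)
    fix p assume "p \<in> P"
    let ?u = "(x (src p), x (dst p))" and ?w = "(y (src p), y (dst p))"
    have "q p ((1 - 1 / 2) *\<^sub>R ?u + (1 / 2) *\<^sub>R ?w) \<le> (1 - 1 / 2) * q p ?u + (1 / 2) * q p ?w"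
      using q_convex[OF \<open>p \<in> P\<close>] by (rule convex_onD) auto
    then show "q p ((1 / 2) *\<^sub>R (x (src p) + y (src p)), (1 / 2) *\<^sub>R (x (dst p) + y (dst p)))
        \<le> (q p ?u + q p ?w) / 2"
      by (simp add: scaleR_add_right add_divide_distrib)
  qed
  also have "\<dots> = ((\<Sum>p\<in>P. q p (x (src p), x (dst p))) + (\<Sum>p\<in>P. q p (y (src p), y (dst p)))) / 2"
    by (simp add: sum_divide_distrib[symmetric] sum.distrib)
  finally show ?thesis
    using f NM unfolding F_def add_divide_distrib by linarith
qed

lemma feasible_midpoint:
  assumes "feasible b x" "feasible b y"
  shows "feasible b (\<lambda>i. (1 / 2) *\<^sub>R (x i + y i))"
  unfolding feasible_def
proof (intro conjI ballI allI impI)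
  fix i assume i: "i \<in> N"
  then have "(1 / 2) *\<^sub>R x i + (1 / 2) *\<^sub>R y i \<in> K i"
    using assms by (intro convexD[OF K_convex]) (auto simp: feasible_def)
  then show "(1 / 2) *\<^sub>R (x i + y i) \<in> K i" by (simp add: scaleR_add_right)
next
  fix i assume "i \<notin> N"
  then show "(1 / 2) *\<^sub>R (x i + y i) = b i"
    using assms by (simp add: feasible_def scaleR_2[symmetric])
qed

lemma f_continuous: "i \<in> M \<Longrightarrow> continuous_on UNIV (f i)"
  using f_differentiable by (intro differentiable_imp_continuous_on) (auto simp: differentiable_on_def)

lemma q_continuous: "p \<in> P \<Longrightarrow> continuous_on UNIV (q p)"
  using q_smooth[unfolded lsmooth_def]
  by (blast intro: continuous_at_imp_continuous_on has_derivative_continuous)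

lemma F_tendsto:
  assumes "\<And>i. (\<lambda>n. X n i) \<longlonglongrightarrow> x i"
  shows "(\<lambda>n. F (X n)) \<longlonglongrightarrow> F x"
  unfolding F_def
  by (intro tendsto_add tendsto_sum continuous_on_tendsto_compose[OF f_continuous]
      continuous_on_tendsto_compose[OF q_continuous] tendsto_Pair assms) auto

lemma minimizer_unique:
  assumes "minimizer b x" "minimizer b y"
  shows "x = y"
proof -
  have fx: "feasible b x" "feasible b y" using assms by (auto simp: minimizer_def)
  have "F x = F y" using assms by (intro antisym) (auto simp: minimizer_def)
  moreover have "F x \<le> F (\<lambda>i. (1 / 2) *\<^sub>R (x i + y i))"
    using assms feasible_midpoint[OF fx] by (auto simp: minimizer_def)
  ultimately have "\<mu> / 8 * (\<Sum>i\<in>N. (norm (x i - y i))\<^sup>2) \<le> 0"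
    using F_midpoint[of x y] by (simp add: field_simps)
  then have "(\<Sum>i\<in>N. (norm (x i - y i))\<^sup>2) \<le> 0"
    using mu_pos by (simp add: mult_le_0_iff)
  then have "(\<Sum>i\<in>N. (norm (x i - y i))\<^sup>2) = 0"
    by (intro antisym sum_nonneg) auto
  then have "\<forall>i\<in>N. x i = y i"
    using finite_N by (simp add: sum_nonneg_eq_0_iff)
  with fx have "x i = y i" for i by (cases "i \<in> N") (auto simp: feasible_def)
  then show ?thesis by (rule ext)
qed

text \<open>No compactness is involved: by \<open>F_midpoint\<close>, two feasible points with
  values near the infimum are close at every free node, so a minimizing sequence is Cauchy, and its
  limit is feasible because the sets \<open>K i\<close> are closed.\<close>

lemma minimizer_exists: "\<exists>x. minimizer b x"
proof -
  define m where "m = Inf (F ` {x. feasible b x})"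
  have "feasible b (\<lambda>i. if i \<in> N then SOME z. z \<in> K i else b i)"
    using K_nonempty by (auto simp: feasible_def some_in_eq)
  then have ne: "F ` {x. feasible b x} \<noteq> {}" by blast
  have bdd: "bdd_below (F ` {x. feasible b x})"
    using F_nonneg by (auto intro!: bdd_belowI[of _ 0])
  have m_le: "m \<le> F x" if "feasible b x" for x
    unfolding m_def using bdd that by (intro cINF_lower) auto
  have "\<exists>x. feasible b x \<and> F x < m + 1 / real (Suc n)" for n
    using cInf_lessD[OF ne, of "m + 1 / real (Suc n)"] unfolding m_def by auto
  then obtain X where X: "\<And>n. feasible b (X n)" "\<And>n. F (X n) < m + 1 / real (Suc n)"
    by metis
  have near: "(norm (X n i - X k i))\<^sup>2 \<le> 8 / \<mu> * (1 / real (Suc n))" if "n \<le> k" for n k i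
  proof (cases "i \<in> N")
    case True
    have "m \<le> F (\<lambda>i. (1 / 2) *\<^sub>R (X n i + X k i))"
      by (intro m_le feasible_midpoint X)
    moreover have "1 / real (Suc k) \<le> 1 / real (Suc n)"
      using that by (intro divide_left_mono) auto
    ultimately have "\<mu> / 8 * (\<Sum>i\<in>N. (norm (X n i - X k i))\<^sup>2) \<le> 1 / real (Suc n)"
      using F_midpoint[of "X n" "X k"] X(2)[of n] X(2)[of k]
      unfolding add_divide_distrib by linarith
    moreover have "(norm (X n i - X k i))\<^sup>2 \<le> (\<Sum>i\<in>N. (norm (X n i - X k i))\<^sup>2)"
      using finite_N True by (intro member_le_sum) auto
    then have "\<mu> / 8 * (norm (X n i - X k i))\<^sup>2 \<le> \<mu> / 8 * (\<Sum>i\<in>N. (norm (X n i - X k i))\<^sup>2)"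
      using mu_pos by (intro mult_left_mono) auto
    ultimately have "\<mu> / 8 * (norm (X n i - X k i))\<^sup>2 \<le> 1 / real (Suc n)" by linarith
    then have "8 / \<mu> * (\<mu> / 8 * (norm (X n i - X k i))\<^sup>2) \<le> 8 / \<mu> * (1 / real (Suc n))"
      using mu_pos by (intro mult_left_mono) auto
    then show ?thesis using mu_pos by simp
  next
    case False
    then show ?thesis using X(1) mu_pos by (auto simp: feasible_def)
  qed
  have "Cauchy (\<lambda>n. X n i)" for i
  proof (rule CauchyI')
    fix e :: real assume "0 < e"
    then have "0 < e\<^sup>2 * \<mu> / 8" using mu_pos by simp
    then obtain n0 where n0: "1 / real (Suc n0) < e\<^sup>2 * \<mu> / 8"
      using reals_Archimedean unfolding inverse_eq_divide by blast
    have "dist (X n i) (X k i) < e" if "n \<ge> n0" "k > n" for n k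
    proof -
      have "1 / real (Suc n) \<le> 1 / real (Suc n0)"
        using that by (intro divide_left_mono) auto
      with n0 have "8 / \<mu> * (1 / real (Suc n)) < 8 / \<mu> * (e\<^sup>2 * \<mu> / 8)"
        using mu_pos by (intro mult_strict_left_mono) auto
      also have "\<dots> = e\<^sup>2" using mu_pos by simp
      finally have "(norm (X n i - X k i))\<^sup>2 < e\<^sup>2"
        using near[of n k i] that by simp
      then show ?thesis
        using \<open>0 < e\<close> by (simp add: dist_norm power_less_imp_less_base)
    qed
    then show "\<exists>M. \<forall>m\<ge>M. \<forall>n>m. dist (X m i) (X n i) < e" by blast
  qed
  then have "\<exists>z. (\<lambda>n. X n i) \<longlonglongrightarrow> z" for i
    using Cauchy_convergent convergent_def by blast
  then obtain x where x: "\<And>i. (\<lambda>n. X n i) \<longlonglongrightarrow> x i" by metis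
  have "feasible b x"
    unfolding feasible_def
  proof (intro conjI ballI allI impI)
    fix i assume "i \<in> N"
    with X(1) show "x i \<in> K i"
      by (intro closed_sequentially[OF K_closed _ x]) (auto simp: feasible_def)
  next
    fix i assume "i \<notin> N"
    with X(1) have "(\<lambda>n. X n i) = (\<lambda>n. b i)" by (auto simp: feasible_def)
    with x[of i] show "x i = b i" by (simp add: LIMSEQ_const_iff)
  qed
  moreover have "F x \<le> m"
  proof (rule LIMSEQ_le[OF F_tendsto[OF x]])
    show "(\<lambda>n. m + 1 / real (Suc n)) \<longlonglongrightarrow> m"
      using tendsto_add[OF tendsto_const[of m] LIMSEQ_inverse_real_of_nat] by (simp add: inverse_eq_divide)
    show "\<exists>N. \<forall>n\<ge>N. F (X n) \<le> m + 1 / real (Suc n)"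
      using X(2) less_imp_le by blast
  qed
  ultimately show ?thesis
    unfolding minimizer_def using m_le order.trans by blast
qed

text \<open>Moving node \<open>i\<close> by the fraction \<open>h * w i\<close> towards
  \<open>x' i\<close> stays in \<open>K i\<close> for every node independently. Since
  \<open>w\<close> vanishes at the fixed nodes, \<open>x'\<close> may obey other boundary data
  \<open>b'\<close>; this allows each of two minimizers to be tested against the other.\<close>

lemma variational_inequality:
  assumes x: "minimizer b x" and x': "feasible b' x'"
    and gf: "\<And>i. i \<in> M \<Longrightarrow> GDERIV (f i) (x i) :> gf i"
    and gq: "\<And>p. p \<in> P \<Longrightarrow> GDERIV (q p) (x (src p), x (dst p)) :> gq p"
    and w: "\<And>i. 0 \<le> w i" "\<And>i. i \<notin> N \<Longrightarrow> w i = 0"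
  shows "0 \<le> (\<Sum>i\<in>M. w i * ((x' i - x i) \<bullet> gf i))
    + (\<Sum>p\<in>P. (w (src p) *\<^sub>R (x' (src p) - x (src p)), w (dst p) *\<^sub>R (x' (dst p) - x (dst p))) \<bullet> gq p)"
    (is "0 \<le> ?L")
proof (rule ccontr)
  define d where "d i = w i *\<^sub>R (x' i - x i)" for i
  let ?\<phi> = "\<lambda>t. F (\<lambda>i. x i + t *\<^sub>R d i)"
  assume "\<not> 0 \<le> ?L"
  moreover have "(?\<phi> has_real_derivative ?L) (at 0)"
  proof -
    have "((\<lambda>t. f i (x i + t *\<^sub>R d i)) has_real_derivative d i \<bullet> gf i) (at 0)" if "i \<in> M" for i
      using GDERIV_along_line[of "f i" "x i" 0 "d i"] gf[OF that] by simp
    moreover have "((\<lambda>t. q p (x (src p) + t *\<^sub>R d (src p), x (dst p) + t *\<^sub>R d (dst p)))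
        has_real_derivative (d (src p), d (dst p)) \<bullet> gq p) (at 0)" if "p \<in> P" for p
      using GDERIV_along_line[of "q p" "(x (src p), x (dst p))" 0 "(d (src p), d (dst p))"] gq[OF that]
      by simp
    ultimately have "(?\<phi> has_real_derivative
        (\<Sum>i\<in>M. d i \<bullet> gf i) + (\<Sum>p\<in>P. (d (src p), d (dst p)) \<bullet> gq p)) (at 0)"
      unfolding F_def by (intro DERIV_add DERIV_sum) auto
    then show ?thesis by (simp add: d_def)
  qed
  ultimately obtain e where e: "0 < e" "\<And>h. 0 < h \<Longrightarrow> h < e \<Longrightarrow> ?\<phi> h < ?\<phi> 0"
    using DERIV_neg_dec_right[of ?\<phi> ?L 0] by auto
  \<comment> \<open>\<open>W\<close> dominates all weights, so \<open>h \<le> 1 / W\<close> keeps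
    every fraction \<open>h * w i\<close> at most 1; the summand 1 keeps \<open>W\<close> positive
    when all weights vanish.\<close>
  define W where "W = 1 + (\<Sum>i\<in>N. w i)"
  have W: "w i \<le> W" "0 < W" for i
  proof -
    have "0 \<le> (\<Sum>i\<in>N. w i)" using w by (intro sum_nonneg) auto
    moreover have "w i \<le> (\<Sum>i\<in>N. w i)" if "i \<in> N"
      using that finite_N w by (intro member_le_sum) auto
    ultimately show "w i \<le> W" "0 < W"
      using w(2)[of i] unfolding W_def by (cases "i \<in> N"; simp add: add.commute)+
  qed
  define h where "h = min (e / 2) (1 / W)"
  have h: "0 < h" "h < e" "h \<le> 1 / W" using e(1) W(2) by (auto simp: h_def)
  have "feasible b (\<lambda>i. x i + h *\<^sub>R d i)"
    unfolding feasible_def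
  proof (intro conjI ballI allI impI)
    fix i assume i: "i \<in> N"
    have "h * w i \<le> 1 / W * W" using h W w by (intro mult_mono) auto
    then have hw: "h * w i \<le> 1" "0 \<le> h * w i" using W(2) h w by auto
    have "(1 - h * w i) *\<^sub>R x i + (h * w i) *\<^sub>R x' i \<in> K i"
      using x x' i hw by (intro convexD[OF K_convex]) (auto simp: minimizer_def feasible_def)
    then show "x i + h *\<^sub>R d i \<in> K i"
      by (simp add: d_def algebra_simps)
  next
    fix i assume "i \<notin> N"
    then show "x i + h *\<^sub>R d i = b i"
      using x w(2) by (simp add: minimizer_def feasible_def d_def)
  qed
  then have "?\<phi> 0 \<le> ?\<phi> h" using x by (simp add: minimizer_def)
  with e(2)[OF h(1,2)] show False by simp
qed

lemma weighted_perturbation_estimate: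
  assumes x: "minimizer b x" and x': "minimizer b' x'"
    and \<theta>: "\<And>i. i \<notin> N \<Longrightarrow> \<theta> i = 0"
  shows "\<mu> * (\<Sum>i\<in>N. (\<theta> i)\<^sup>2 * (norm (x i - x' i))\<^sup>2)
    \<le> (\<Sum>p\<in>P. l p / 2 * (\<theta> (src p) - \<theta> (dst p))\<^sup>2
        * norm (x (src p) - x' (src p)) * norm (x (dst p) - x' (dst p)))"
proof -
  have "\<exists>G. \<forall>x. GDERIV (f i) x :> G x" if "i \<in> M" for i
  proof (intro choice allI)
    fix x
    obtain D where "(f i has_derivative D) (at x)"
      using f_differentiable[OF \<open>i \<in> M\<close>, of x] unfolding differentiable_def by blast
    then show "\<exists>G. GDERIV (f i) x :> G"
      by (blast intro: has_derivative_imp_GDERIV)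
  qed
  then have "\<exists>gf. \<forall>i\<in>M. \<forall>x. GDERIV (f i) x :> gf i x" by (intro bchoice) auto
  then obtain gf where gf: "\<And>i x. i \<in> M \<Longrightarrow> GDERIV (f i) x :> gf i x" by blast
  have "\<exists>G. (\<forall>x. GDERIV (q p) x :> G x) \<and> (\<forall>x y. norm (G x - G y) \<le> l p * norm (x - y))"
    if "p \<in> P" for p
    by (rule lsmooth_gradient[OF q_smooth[OF that]]) blast
  then have "\<exists>gq. \<forall>p\<in>P. (\<forall>x. GDERIV (q p) x :> gq p x)
      \<and> (\<forall>x y. norm (gq p x - gq p y) \<le> l p * norm (x - y))" by (intro bchoice) auto
  then obtain gq where gq: "\<And>p x. p \<in> P \<Longrightarrow> GDERIV (q p) x :> gq p x"
    and gq_lip: "\<And>p x y. p \<in> P \<Longrightarrow> norm (gq p x - gq p y) \<le> l p * norm (x - y)" by blast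
  define X X' where "X p = (x (src p), x (dst p))" and "X' p = (x' (src p), x' (dst p))" for p
  define \<delta> where "\<delta> i = x i - x' i" for i
  define w where "w i = (\<theta> i)\<^sup>2" for i
  define W where "W p = (w (src p) *\<^sub>R \<delta> (src p), w (dst p) *\<^sub>R \<delta> (dst p))" for p
  have w: "\<And>i. 0 \<le> w i" "\<And>i. i \<notin> N \<Longrightarrow> w i = 0" using \<theta> by (auto simp: w_def)
  have fx: "feasible b x" "feasible b' x'" using x x' by (auto simp: minimizer_def)
  have "0 \<le> (\<Sum>i\<in>M. - (w i * (\<delta> i \<bullet> gf i (x i)))) + (\<Sum>p\<in>P. - (W p \<bullet> gq p (X p)))"
    using variational_inequality[OF x fx(2) gf gq w]
    by (simp add: W_def X_def \<delta>_def inner_diff_left inner_diff_right algebra_simps inner_prod_def)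
  moreover have "0 \<le> (\<Sum>i\<in>M. w i * (\<delta> i \<bullet> gf i (x' i))) + (\<Sum>p\<in>P. W p \<bullet> gq p (X' p))"
    using variational_inequality[OF x' fx(1) gf gq w]
    by (simp add: W_def X'_def \<delta>_def)
  ultimately have "(\<Sum>i\<in>M. w i * (\<delta> i \<bullet> (gf i (x i) - gf i (x' i)))) + (\<Sum>p\<in>P. W p \<bullet> (gq p (X p) - gq p (X' p))) \<le> 0"
    by (simp add: inner_diff_right sum_subtractf sum_negf right_diff_distrib)
  moreover have "\<mu> * (\<Sum>i\<in>N. w i * (norm (\<delta> i))\<^sup>2) \<le> (\<Sum>i\<in>M. w i * (\<delta> i \<bullet> (gf i (x i) - gf i (x' i))))"
  proof -
    have "\<mu> * (\<Sum>i\<in>N. w i * (norm (\<delta> i))\<^sup>2) = (\<Sum>i\<in>M. w i * (\<mu> * (norm (\<delta> i))\<^sup>2))"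
      unfolding sum_distrib_left by (rule sum.mono_neutral_cong_left[OF finite_M N_subset]) (auto simp: w)
    also have "\<dots> \<le> (\<Sum>i\<in>M. w i * (\<delta> i \<bullet> (gf i (x i) - gf i (x' i))))"
      unfolding \<delta>_def
      by (intro sum_mono mult_left_mono strongly_convex_gradient_monotone[OF f_strongly_convex gf gf] w)
    finally show ?thesis .
  qed
  \<comment> \<open>Co-coercivity holds for the gradient on the product space only; split into its
    two blocks it is exactly the hypothesis of \<open>weighted_cocoercive\<close>, which then
    tolerates different weights on the blocks.\<close>
  moreover have "- (\<Sum>p\<in>P. l p / 2 * (\<theta> (src p) - \<theta> (dst p))\<^sup>2 * norm (\<delta> (src p)) * norm (\<delta> (dst p)))
      \<le> (\<Sum>p\<in>P. W p \<bullet> (gq p (X p) - gq p (X' p)))"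
    unfolding sum_negf[symmetric]
  proof (rule sum_mono)
    fix p assume p: "p \<in> P"
    obtain G G' where G: "gq p (X p) - gq p (X' p) = (G, G')" by (cases "gq p (X p) - gq p (X' p)")
    have "(norm (G, G'))\<^sup>2 \<le> l p * ((X p - X' p) \<bullet> (G, G'))"
      using smooth_convex_cocoercive[OF q_convex[OF p] gq[OF p] gq_lip[OF p] l_nonneg[OF p], of "X p" "X' p"]
      by (simp add: G)
    then have "(norm G)\<^sup>2 + (norm G')\<^sup>2 \<le> l p * (\<delta> (src p) \<bullet> G + \<delta> (dst p) \<bullet> G')"
      by (simp add: X_def X'_def \<delta>_def norm_Pair)
    from weighted_cocoercive[OF this l_nonneg[OF p]]
    show "- (l p / 2 * (\<theta> (src p) - \<theta> (dst p))\<^sup>2 * norm (\<delta> (src p)) * norm (\<delta> (dst p)))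
        \<le> W p \<bullet> (gq p (X p) - gq p (X' p))"
      unfolding G by (simp add: W_def w_def)
  qed
  ultimately show ?thesis by (simp add: w_def \<delta>_def)
qed

text \<open>Turns the quadratic estimate into a linear one: the parts \<open>T p\<close> are
  absorbed by the share \<open>1 - c\<close> of \<open>\<mu> * S\<close>, and the rest is divided by
  \<open>sqrt S\<close>. \<open>T\<close> is meant for couplings between free nodes,
  \<open>R\<close> for couplings to fixed ones.\<close>

lemma weighted_perturbation_bound:
  assumes x: "minimizer b x" and x': "minimizer b' x'"
    and \<theta>: "\<And>i. i \<notin> N \<Longrightarrow> \<theta> i = 0"
    and S: "S = (\<Sum>i\<in>N. (\<theta> i)\<^sup>2 * (norm (x i - x' i))\<^sup>2)"
    and terms: "\<And>p. p \<in> P \<Longrightarrow> l p / 2 * (\<theta> (src p) - \<theta> (dst p))\<^sup>2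
        * norm (x (src p) - x' (src p)) * norm (x (dst p) - x' (dst p)) \<le> T p + sqrt S * R p"
    and T: "(\<Sum>p\<in>P. T p) \<le> (1 - c) * \<mu> * S"
    and R: "\<And>p. p \<in> P \<Longrightarrow> 0 \<le> R p"
  shows "c * \<mu> * sqrt S \<le> (\<Sum>p\<in>P. R p)"
proof (cases "sqrt S = 0")
  case True
  then show ?thesis using R by (simp add: sum_nonneg)
next
  case False
  have S0: "0 \<le> S" unfolding S by (intro sum_nonneg) auto
  have "\<mu> * S \<le> (\<Sum>p\<in>P. T p + sqrt S * R p)"
    unfolding S using weighted_perturbation_estimate[OF x x' \<theta>] terms[unfolded S]
    by (meson order.trans sum_mono)
  then have "\<mu> * S \<le> (1 - c) * \<mu> * S + sqrt S * (\<Sum>p\<in>P. R p)"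
    using T by (simp add: sum.distrib sum_distrib_left)
  then have "c * \<mu> * S \<le> sqrt S * (\<Sum>p\<in>P. R p)"
    by (simp add: algebra_simps)
  then have "sqrt S * (c * \<mu> * sqrt S) \<le> sqrt S * (\<Sum>p\<in>P. R p)"
    using S0 real_sqrt_mult_self[of S] by (simp add: mult.commute mult.left_commute)
  moreover have "0 < sqrt S" using False S0 by simp
  ultimately show ?thesis by (rule mult_left_le_imp_le)
qed

end

subsection \<open>Graph distances and degrees\<close>

lemma adj_sym: "adj E u w \<longleftrightarrow> adj E w u"
  by (auto simp: adj_def)

lemma walk_refl: "u \<in> V \<Longrightarrow> walk V E 0 u u"
  unfolding walk_def by auto

lemma walk_adj: "u \<in> V \<Longrightarrow> w \<in> V \<Longrightarrow> adj E u w \<Longrightarrow> walk V E 1 u w"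
  unfolding walk_def by (intro exI[of _ "\<lambda>i. if i = 0 then u else w"]) auto

lemma walk_reverse:
  assumes "walk V E n u w"
  shows "walk V E n w u"
proof -
  obtain p where p: "p 0 = u" "p n = w" "\<forall>i\<le>n. p i \<in> V" "\<forall>i<n. adj E (p i) (p (Suc i))"
    using assms unfolding walk_def by blast
  have "adj E (p (n - i)) (p (n - Suc i))" if "i < n" for i
  proof -
    have "Suc (n - Suc i) = n - i" using that by simp
    then show ?thesis using p(4)[rule_format, of "n - Suc i"] that by (simp add: adj_sym)
  qed
  with p show ?thesis
    unfolding walk_def by (intro exI[of _ "\<lambda>i. p (n - i)"]) auto
qed

lemma walk_append:
  assumes "walk V E n u w" "walk V E k w x"
  shows "walk V E (n + k) u x"
proof -
  obtain p where p: "p 0 = u" "p n = w" "\<forall>i\<le>n. p i \<in> V" "\<forall>i<n. adj E (p i) (p (Suc i))"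
    using assms(1) unfolding walk_def by blast
  obtain q where q: "q 0 = w" "q k = x" "\<forall>i\<le>k. q i \<in> V" "\<forall>i<k. adj E (q i) (q (Suc i))"
    using assms(2) unfolding walk_def by blast
  define r where "r i = (if i < n then p i else q (i - n))" for i
  have r: "r i = p i" if "i \<le> n" for i using that p q by (cases "i = n") (auto simp: r_def)
  have "adj E (r i) (r (Suc i))" if "i < n + k" for i
  proof (cases "i < n")
    case True
    then show ?thesis using p(4) r[of i] r[of "Suc i"] by simp
  next
    case False
    then show ?thesis using q(4)[rule_format, of "i - n"] that by (simp add: r_def Suc_diff_le)
  qed
  moreover have "r i \<in> V" if "i \<le> n + k" for i
    using p(3) q(3) that by (auto simp: r_def)
  moreover have "r 0 = u" "r (n + k) = x"
    using r[of 0] p(1) q(2) by (auto simp: r_def)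
  ultimately show ?thesis unfolding walk_def by blast
qed

lemma gdist_le: "walk V E n u w \<Longrightarrow> gdist V E u w \<le> enat n"
  unfolding gdist_def by (intro Inf_lower) blast

lemma walk_gdist:
  assumes "gdist V E u w = enat n"
  shows "walk V E n u w"
proof -
  let ?S = "{enat n | n. walk V E n u w}"
  have ne: "?S \<noteq> {}" using assms unfolding gdist_def Inf_enat_def by (auto split: if_splits)
  then have "Inf ?S = (LEAST x. x \<in> ?S)" unfolding Inf_enat_def by (rule if_not_P)
  moreover have "(LEAST x. x \<in> ?S) \<in> ?S" by (rule LeastI_ex) (use ne in blast)
  ultimately show ?thesis using assms unfolding gdist_def by auto
qed

lemma gdist_le_iff: "gdist V E u w \<le> enat n \<longleftrightarrow> (\<exists>k\<le>n. walk V E k u w)"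
proof
  assume *: "gdist V E u w \<le> enat n"
  then obtain k where k: "gdist V E u w = enat k"
    by (cases "gdist V E u w") simp_all
  with * have "k \<le> n" by simp
  with walk_gdist[OF k] show "\<exists>k\<le>n. walk V E k u w" by (intro exI conjI)
next
  assume "\<exists>k\<le>n. walk V E k u w"
  then obtain k where "k \<le> n" "walk V E k u w" by (elim exE conjE)
  then have "gdist V E u w \<le> enat k" "enat k \<le> enat n" by (simp_all add: gdist_le)
  then show "gdist V E u w \<le> enat n" by (rule order.trans)
qed

lemma gdist_sym: "gdist V E u w = gdist V E w u"
proof -
  have "walk V E n u w \<longleftrightarrow> walk V E n w u" for n by (rule iffI; erule walk_reverse)
  then show ?thesis unfolding gdist_def by simp
qed

lemma gdist_refl: "u \<in> V \<Longrightarrow> gdist V E u u = 0"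
  using gdist_le[OF walk_refl, of u V E] by (simp add: zero_enat_def[symmetric])

lemma gdist_triangle:
  assumes "gdist V E u w \<le> enat n" "gdist V E w x \<le> enat k"
  shows "gdist V E u x \<le> enat (n + k)"
proof -
  obtain n' k' where "n' \<le> n" "walk V E n' u w" "k' \<le> k" "walk V E k' w x"
    using assms unfolding gdist_le_iff by blast
  then show ?thesis
    unfolding gdist_le_iff by (intro exI[of _ "n' + k'"]) (auto intro: walk_append)
qed

lemma gdist_adj:
  assumes "u \<in> V" "w \<in> V" "adj E u w" "gdist V E x u = enat d"
  shows "gdist V E x w \<le> enat (Suc d)"
  using gdist_triangle[of V E x u d w 1] gdist_le[OF walk_adj[OF assms(1-3)]] assms(4) by simp

text \<open>The last but one vertex of a shortest walk has distance exactly \<open>d\<close>, since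
  a smaller one would shorten the way to \<open>u\<close>; the induction continues from
  there.\<close>

lemma gdist_intermediate:
  assumes "gdist V E v u = enat d" "\<gamma> \<le> d" "u \<in> V"
  shows "\<exists>w\<in>V. gdist V E v w = enat \<gamma>"
  using assms
proof (induction d arbitrary: u)
  case (Suc d)
  show ?case
  proof (cases "\<gamma> = Suc d")
    case False
    obtain p where p: "p 0 = v" "p (Suc d) = u" "\<forall>i\<le>Suc d. p i \<in> V" "\<forall>i<Suc d. adj E (p i) (p (Suc i))"
      using walk_gdist[OF Suc.prems(1)] unfolding walk_def by blast
    then have "walk V E d v (p d)" unfolding walk_def by (intro exI[of _ p]) auto
    then obtain e where e: "gdist V E v (p d) = enat e" "e \<le> d"
      using gdist_le[of V E d v "p d"] by (cases "gdist V E v (p d)") auto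
    have "gdist V E v u \<le> enat (Suc e)"
      using p by (intro gdist_adj[OF _ _ _ e(1)]) auto
    with Suc.prems e have "e = d" by simp
    then show ?thesis using Suc.IH[OF e(1)[unfolded \<open>e = d\<close>]] p Suc.prems(2) False by auto
  qed (use Suc.prems in auto)
qed auto

text \<open>A vertex at distance \<open>\<gamma>\<close> from \<open>v\<close> exists on a shortest
  walk to \<open>u\<close>. This is the source of the lower bounds on \<open>const_a\<close> and
  \<open>const_atil\<close>.\<close>

lemma hgrowth_pos:
  assumes V: "finite V" and vu: "v \<in> V" "u \<in> V" and d: "gdist V E v u = enat d" and "\<gamma> \<le> d"
  shows "1 \<le> hgrowth V E \<gamma>"
proof -
  obtain w where w: "w \<in> V" "gdist V E w v = enat \<gamma>"
    using gdist_intermediate[OF d \<open>\<gamma> \<le> d\<close> vu(2)] by (auto simp: gdist_sym)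
  then have "w \<in> bdry V E v \<gamma>"
    by (cases "\<gamma> = 0") (auto simp: bdry_def nbhd_def)
  moreover have "finite (bdry V E v \<gamma>)"
    using V by (auto simp: bdry_def nbhd_def)
  ultimately have "1 \<le> card (bdry V E v \<gamma>)"
    by (auto simp: Suc_le_eq card_gt_0_iff)
  also have "\<dots> \<le> hgrowth V E \<gamma>"
    unfolding hgrowth_def using V vu by (intro Max_ge) auto
  finally show ?thesis .
qed

text \<open>\<open>D\<close> is the largest finite distance, so disconnected graphs are covered. The
  last property makes \<open>1 / D\<close> a genuine inverse whenever there is an edge.\<close>

lemma finite_diameter:
  assumes G: "undirected_graph V E" and "v \<in> V"
  obtains D where "\<And>u w d. u \<in> V \<Longrightarrow> w \<in> V \<Longrightarrow> gdist V E u w = enat d \<Longrightarrow> d \<le> D"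
    and "\<And>\<gamma>. \<gamma> \<le> D \<Longrightarrow> 1 \<le> hgrowth V E \<gamma>" and "E \<noteq> {} \<Longrightarrow> 1 \<le> D"
proof -
  have V: "finite V" using G by (simp add: undirected_graph_def)
  define S where "S = {d. \<exists>u\<in>V. \<exists>w\<in>V. gdist V E u w = enat d}"
  have "S \<subseteq> (\<lambda>(u, w). the_enat (gdist V E u w)) ` (V \<times> V)"
    unfolding S_def by force
  then have fin: "finite S" using V finite_subset by blast
  have le: "d \<le> Max S" if "u \<in> V" "w \<in> V" "gdist V E u w = enat d" for u w d
    using that fin by (intro Max_ge) (auto simp: S_def)
  have "0 \<in> S"
    using gdist_refl[OF \<open>v \<in> V\<close>] \<open>v \<in> V\<close> unfolding S_def zero_enat_def by auto
  then have "Max S \<in> S" using fin by (intro Max_in) auto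
  then have "1 \<le> hgrowth V E \<gamma>" if "\<gamma> \<le> Max S" for \<gamma>
    using hgrowth_pos[OF V] that unfolding S_def by blast
  moreover have "1 \<le> Max S" if "E \<noteq> {}"
  proof -
    obtain a b where ab: "(a, b) \<in> E" using \<open>E \<noteq> {}\<close> by fast
    then have abV: "a \<in> V" "b \<in> V" "a \<noteq> b" using G by (auto simp: undirected_graph_def)
    have "gdist V E a b \<le> enat 1"
      using ab abV by (intro gdist_le walk_adj) (auto simp: adj_def)
    moreover have "gdist V E a b \<noteq> enat 0"
    proof
      assume "gdist V E a b = enat 0"
      from walk_gdist[OF this] abV(3) show False unfolding walk_def by auto
    qed
    ultimately have "gdist V E a b = enat 1"
      by (cases "gdist V E a b") (auto simp: le_Suc_eq)
    then show ?thesis using le[OF abV(1,2)] by simp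
  qed
  ultimately show ?thesis using that le by blast
qed

text \<open>Each undirected edge has one orientation in \<open>E\<close>, so the neighbours met
  through outgoing and through incoming pairs form disjoint sets.\<close>

lemma card_edges_at_le_max_degree:
  assumes G: "undirected_graph V E" and "E' \<subseteq> E" "u \<in> V"
  shows "card {e \<in> E'. fst e = u} + card {e \<in> E'. snd e = u} \<le> max_degree V E"
proof -
  have V: "finite V" "E \<subseteq> V \<times> V" and anti: "\<And>u w. (u, w) \<in> E \<Longrightarrow> (w, u) \<notin> E"
    using G by (auto simp: undirected_graph_def)
  have fin: "finite E'" using V assms(2) by (meson finite_SigmaI finite_subset)
  have "card {e \<in> E'. fst e = u} = card (snd ` {e \<in> E'. fst e = u})"
    by (rule card_image[symmetric]) (auto simp: inj_on_def)
  moreover have "card {e \<in> E'. snd e = u} = card (fst ` {e \<in> E'. snd e = u})"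
    by (rule card_image[symmetric]) (auto simp: inj_on_def)
  moreover have "snd ` {e \<in> E'. fst e = u} \<inter> fst ` {e \<in> E'. snd e = u} = {}"
    using anti assms(2) by force
  ultimately have "card {e \<in> E'. fst e = u} + card {e \<in> E'. snd e = u}
      = card (snd ` {e \<in> E'. fst e = u} \<union> fst ` {e \<in> E'. snd e = u})"
    using fin by (simp add: card_Un_disjoint)
  also have "\<dots> \<le> card {w \<in> V. adj E u w}"
    using V assms(2) by (intro card_mono) (auto simp: adj_def)
  also have "\<dots> \<le> max_degree V E"
    unfolding max_degree_def using V \<open>u \<in> V\<close> by (intro Max_ge) auto
  finally show ?thesis .
qed

lemma sum_edge_endpoints_le:
  fixes h :: "'v \<Rightarrow> real"
  assumes G: "undirected_graph V E" and E': "E' \<subseteq> E" "E' \<subseteq> U \<times> U" and U: "U \<subseteq> V"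
    and h: "\<And>u. u \<in> U \<Longrightarrow> 0 \<le> h u"
  shows "(\<Sum>e\<in>E'. h (fst e) + h (snd e)) \<le> Delta V E * (\<Sum>u\<in>U. h u)"
proof -
  have fin: "finite E'" "finite U" using G E' U unfolding undirected_graph_def
    by (meson finite_SigmaI finite_subset)+
  have *: "(\<Sum>e\<in>E'. h (g e)) = (\<Sum>u\<in>U. real (card {e \<in> E'. g e = u}) * h u)"
    if "g ` E' \<subseteq> U" for g
    using sum.group[OF fin that, of "\<lambda>e. h (g e)"] by simp
  have "(\<Sum>e\<in>E'. h (fst e) + h (snd e)) = (\<Sum>e\<in>E'. h (fst e)) + (\<Sum>e\<in>E'. h (snd e))"
    by (rule sum.distrib)
  also have "\<dots> = (\<Sum>u\<in>U. real (card {e \<in> E'. fst e = u}) * h u)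
      + (\<Sum>u\<in>U. real (card {e \<in> E'. snd e = u}) * h u)"
    using E'(2) by (intro arg_cong2[of _ _ _ _ "(+)"] *) auto
  also have "\<dots> = (\<Sum>u\<in>U. real (card {e \<in> E'. fst e = u} + card {e \<in> E'. snd e = u}) * h u)"
    by (simp add: sum.distrib distrib_right)
  also have "\<dots> \<le> (\<Sum>u\<in>U. Delta V E * h u)"
    using U h unfolding Delta_def
    by (intro sum_mono mult_right_mono of_nat_mono card_edges_at_le_max_degree[OF G E'(1)]) auto
  finally show ?thesis by (simp add: sum_distrib_left)
qed

subsection \<open>Rates and constants\<close>

text \<open>As \<open>1 / (1 + 1 / D) = 1 - 1 / (D + 1)\<close>, the product is
  \<open>1 - p ^ (D + 1) + ?P * p / (D + 1)\<close>, and the last term repays the truncation because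
  each of the \<open>D + 1\<close> summands of \<open>?P\<close> is at least \<open>p ^ D\<close>.
  So the truncated sum can replace the full series, even at \<open>p = 1\<close>.\<close>

lemma truncated_geometric_sum_ge:
  fixes p :: real
  assumes p: "0 \<le> p" "p \<le> 1" and D: "1 \<le> D"
  shows "1 \<le> (\<Sum>\<gamma>\<le>D. p ^ \<gamma>) * (1 - p / (1 + 1 / real D))"
proof -
  let ?P = "\<Sum>\<gamma>\<le>D. p ^ \<gamma>"
  have "?P \<ge> (\<Sum>\<gamma>\<le>D. p ^ D)"
    using p by (intro sum_mono power_decreasing) auto
  then have "real (D + 1) * p ^ D \<le> ?P" by simp
  then have "p * (real (D + 1) * p ^ D) \<le> p * ?P"
    using p(1) by (rule mult_left_mono)
  then have "p ^ Suc D \<le> ?P * p / real (D + 1)"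
    by (simp add: field_simps)
  moreover have "(1 - p) * ?P = 1 - p ^ Suc D" by (rule sum_gp_basic)
  moreover have "?P * (1 - p / (1 + 1 / real D)) = (1 - p) * ?P + ?P * p / real (D + 1)"
  proof -
    have "1 / (1 + 1 / real D) = 1 - 1 / real (D + 1)"
      using D by (simp add: field_simps)
    then have "p / (1 + 1 / real D) = p * (1 - 1 / real (D + 1))"
      by (metis times_divide_eq_right mult.right_neutral)
    then show ?thesis unfolding \<open>p / (1 + 1 / real D) = _\<close> by (simp add: algebra_simps)
  qed
  ultimately show ?thesis by linarith
qed

text \<open>Enlarging the rate by the factor \<open>s\<close> costs at most \<open>s ^ D \<le> e\<close> over the diameter \<open>D\<close>, and it
  leaves a margin even if \<open>p * q\<close>, which is \<open>1 / (1 + b\<^sub>1 + b\<^sub>2)\<close> below, is arbitrarily close to \<open>1\<close>.\<close>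
lemma coercivity_margin:
  fixes p q a a' :: real and D :: nat
  defines "s \<equiv> 1 + 1 / real D"
  defines "c \<equiv> 1 - p * q / s - 1 / (8 * a')"
  assumes p: "0 \<le> p" "p \<le> 1" and q: "0 \<le> q" "q \<le> 1" and D: "1 \<le> D" and "d \<le> D"
    and a: "(\<Sum>\<gamma>\<le>D. q ^ \<gamma>) \<le> a" and a': "(\<Sum>\<gamma>\<le>D. p ^ \<gamma>) \<le> a'"
  shows "0 < c" and "s ^ d \<le> 4 * a\<^sup>2 * c"
proof -
  let ?P = "\<Sum>\<gamma>\<le>D. p ^ \<gamma>" and ?Q = "\<Sum>\<gamma>\<le>D. q ^ \<gamma>"
  have s: "1 \<le> s" using D by (simp add: s_def)
  have P: "1 \<le> ?P" "1 \<le> ?Q"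
    using p q member_le_sum[of 0 "{..D}" "\<lambda>\<gamma>. p ^ \<gamma>"] member_le_sum[of 0 "{..D}" "\<lambda>\<gamma>. q ^ \<gamma>"] by auto
  have PP: "1 \<le> ?P * (1 - p / s)" and QQ: "1 \<le> ?Q * (1 - q / s)"
    using truncated_geometric_sum_ge[OF p D] truncated_geometric_sum_ge[OF q D] by (simp_all add: s_def)
  \<comment> \<open>The temporal share \<open>1 / (8 * a')\<close> is at most an eighth of what the
    spatial share \<open>p * q / s\<close> leaves, so seven eighths of that survive.\<close>
  have "1 / a' \<le> 1 / ?P" using P a' by (intro divide_left_mono) auto
  also have "\<dots> \<le> 1 - p / s" using PP P by (simp add: field_simps)
  also have "\<dots> \<le> 1 - p * q / s"
    using p q s mult_left_mono[OF q(2) p(1)] by (simp add: divide_right_mono)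
  finally have "1 / (8 * a') \<le> (1 - p * q / s) / 8" by (simp add: field_simps)
  moreover have "1 - q / s \<le> 1 - p * q / s"
    using p q s mult_right_mono[OF p(2) q(1)] by (simp add: divide_right_mono)
  moreover define X Y Z where "X = 1 - p * q / s" and "Y = 1 / (8 * a')" and "Z = 1 - q / s"
  ultimately have "Y \<le> X / 8" "Z \<le> X" by simp_all
  then have "7 / 8 * Z \<le> X - Y" by linarith
  then have c: "7 / 8 * (1 - q / s) \<le> c" by (simp add: c_def X_def Y_def Z_def)
  have pos: "0 < 1 - q / s" using QQ P by (smt (verit) mult_nonneg_nonpos)
  then have "0 < 7 / 8 * (1 - q / s)" by (intro mult_pos_pos) auto
  with c show "0 < c" by (rule less_le_trans[rotated])
  \<comment> \<open>One factor of \<open>a\<close> compensates the margin \<open>1 - q / s\<close>,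
    the other one is merely at least 1.\<close>
  have "1 * 1 \<le> ?Q * (?Q * (1 - q / s))" using P QQ by (intro mult_mono) auto
  also have "\<dots> = ?Q\<^sup>2 * (1 - q / s)" by (simp add: power2_eq_square)
  also have "\<dots> \<le> a\<^sup>2 * (1 - q / s)"
    using a P pos by (intro mult_right_mono power_mono) auto
  finally have Q: "1 * 1 \<le> a\<^sup>2 * (1 - q / s)" .
  \<comment> \<open>The constant 4 of the claim suffices because \<open>4 * 7 / 8 = 7 / 2\<close>
    exceeds \<open>exp 1\<close>, the bound for \<open>s ^ D\<close>.\<close>
  have "7 / 2 * (1 * 1) \<le> 7 / 2 * (a\<^sup>2 * (1 - q / s))" by (intro mult_left_mono Q) auto
  also have "\<dots> = 4 * a\<^sup>2 * (7 / 8 * (1 - q / s))" by algebra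
  also have "\<dots> \<le> 4 * a\<^sup>2 * c" using c by (intro mult_left_mono) auto
  finally have "7 / 2 \<le> 4 * a\<^sup>2 * c" by simp
  moreover have "s ^ d \<le> s ^ D" using s \<open>d \<le> D\<close> by (rule power_increasing[rotated])
  moreover have "s ^ D \<le> exp 1"
    using exp_ge_one_plus_x_over_n_power_n[of D 1] D by (simp add: s_def)
  ultimately show "s ^ d \<le> 4 * a\<^sup>2 * c" using exp_le by linarith
qed

lemma geometric_sum_le_weighted_suminf:
  fixes p :: real
  assumes "summable (\<lambda>\<gamma>. p ^ \<gamma> * real (h \<gamma>))" and p: "0 \<le> p"
    and h: "\<And>\<gamma>. \<gamma> \<le> D \<Longrightarrow> 1 \<le> h \<gamma>"
  shows "(\<Sum>\<gamma>\<le>D. p ^ \<gamma>) \<le> (\<Sum>\<gamma>. p ^ \<gamma> * real (h \<gamma>))"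
proof -
  have "(\<Sum>\<gamma>\<le>D. p ^ \<gamma>) \<le> (\<Sum>\<gamma>\<le>D. p ^ \<gamma> * real (h \<gamma>))"
  proof (rule sum_mono)
    fix \<gamma> assume "\<gamma> \<in> {..D}"
    then show "p ^ \<gamma> \<le> p ^ \<gamma> * real (h \<gamma>)"
      using h[of \<gamma>] p mult_left_mono[of 1 "real (h \<gamma>)" "p ^ \<gamma>"] by simp
  qed
  also have "\<dots> \<le> (\<Sum>\<gamma>. p ^ \<gamma> * real (h \<gamma>))"
    using assms by (intro sum_le_suminf) auto
  finally show ?thesis .
qed

lemma const_a_ge:
  assumes "summable (\<lambda>\<gamma>. ((1 + b1) / (1 + b1 + b2)) ^ \<gamma> * real (hgrowth V E \<gamma>))" "0 < b1" "0 < b2"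
    and h: "\<And>\<gamma>. \<gamma> \<le> D \<Longrightarrow> 1 \<le> hgrowth V E \<gamma>"
  shows "(\<Sum>\<gamma>\<le>D. ((1 + b1) / (1 + b1 + b2)) ^ \<gamma>) \<le> const_a V E b1 b2"
  unfolding const_a_def using assms by (intro geometric_sum_le_weighted_suminf) auto

lemma const_atil_ge:
  assumes "summable (\<lambda>\<gamma>. (1 / (1 + b1)) ^ \<gamma> * real (hgrowth V E \<gamma>))" "0 < b1"
    and h: "\<And>\<gamma>. \<gamma> \<le> D \<Longrightarrow> 1 \<le> hgrowth V E \<gamma>"
  shows "(\<Sum>\<gamma>\<le>D. (1 / (1 + b1)) ^ \<gamma>) \<le> const_atil V E b1"
  unfolding const_atil_def using assms by (intro geometric_sum_le_weighted_suminf) auto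

lemma Delta_nonneg: "0 \<le> Delta V E"
  by (simp add: Delta_def)

lemma Delta_pos:
  assumes "undirected_graph V E" "E \<noteq> {}"
  shows "0 < Delta V E"
proof -
  obtain a b where ab: "(a, b) \<in> E" using assms(2) by fast
  then have V: "finite V" "a \<in> V" "b \<in> V" using assms(1) by (auto simp: undirected_graph_def)
  have "card {e \<in> {(a, b)}. fst e = a} + card {e \<in> {(a, b)}. snd e = a} \<le> max_degree V E"
    using ab V by (intro card_edges_at_le_max_degree[OF assms(1)]) auto
  moreover have "{e \<in> {(a, b)}. fst e = a} = {(a, b)}" by auto
  ultimately show ?thesis by (simp add: Delta_def)
qed

lemma Delta_no_edges: "Delta V {} = 0"
  by (cases "V = {}") (simp_all add: Delta_def max_degree_def adj_def image_constant_conv)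

text \<open>Among the rates \<open>x\<close>, \<open>\<gamma>\<^sub>S\<close> is the one at which the loss \<open>\<Delta> \<ell>\<^sub>S (1 - x)\<^sup>2 / (4 x)\<close> caused by
  spatial weights \<open>x ^ d\<close> exhausts the strong convexity \<open>\<mu>\<close>.\<close>
lemma gammaS_critical:
  assumes mu: "0 < \<mu>" and lS: "0 \<le> lS"
  shows "Delta V E * lS * (1 - gammaS V E \<mu> lS)\<^sup>2 = 4 * \<mu> * gammaS V E \<mu> lS"
    and "0 \<le> gammaS V E \<mu> lS"
    and "0 < Delta V E * lS \<Longrightarrow> 0 < gammaS V E \<mu> lS"
proof -
  define w where "w = Delta V E * lS / \<mu>"
  define R where "R = sqrt (1 + w)"
  have w: "0 \<le> w" using mu lS Delta_nonneg[of V E] by (simp add: w_def)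
  then have R: "1 \<le> R" "R\<^sup>2 = 1 + w" by (simp_all add: R_def)
  have g: "gammaS V E \<mu> lS = (R - 1) / (R + 1)" by (simp add: gammaS_def R_def w_def)
  have "1 - gammaS V E \<mu> lS = 2 / (R + 1)" using R(1) by (simp add: g field_simps)
  then have "w * (1 - gammaS V E \<mu> lS)\<^sup>2 = 4 * (w / (R + 1)\<^sup>2)"
    by (simp add: power_divide)
  also have "w = (R - 1) * (R + 1)" using R(2) by (simp add: power2_eq_square algebra_simps)
  also have "(R - 1) * (R + 1) / (R + 1)\<^sup>2 = gammaS V E \<mu> lS"
    using R(1) by (simp add: g power2_eq_square)
  finally have "w * (1 - gammaS V E \<mu> lS)\<^sup>2 = 4 * gammaS V E \<mu> lS"
    by (simp add: \<open>w = (R - 1) * (R + 1)\<close>)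
  then have "\<mu> * (w * (1 - gammaS V E \<mu> lS)\<^sup>2) = \<mu> * (4 * gammaS V E \<mu> lS)" by simp
  moreover have "\<mu> * w = Delta V E * lS" using mu by (simp add: w_def)
  ultimately show "Delta V E * lS * (1 - gammaS V E \<mu> lS)\<^sup>2 = 4 * \<mu> * gammaS V E \<mu> lS"
    by (metis mult.assoc mult.commute)
  show "0 \<le> gammaS V E \<mu> lS" using R(1) by (simp add: g)
  show "0 < gammaS V E \<mu> lS" if "0 < Delta V E * lS"
  proof -
    have "0 < w" using that mu by (simp add: w_def)
    then have "1 < R" by (simp add: R_def)
    then show ?thesis by (simp add: g)
  qed
qed

text \<open>Allocates the strong convexity: a share for couplings along edges, controlled by
  \<open>\<kappa>\<close>, the share \<open>1 / (8 * const_atil V E b1)\<close> for couplings in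
  time, and the rest \<open>c\<close>. The final estimate is divided by \<open>c\<close>; the factor
  \<open>c\<close> in the last property cancels this, so a small \<open>c\<close> does no
  harm.\<close>

lemma decay_parameters:
  assumes G: "undirected_graph V E" and v: "v \<in> V" and mu: "0 < \<mu>" and lS: "0 \<le> lS"
    and b: "0 < b1" "0 < b2"
    and sa: "summable (\<lambda>\<gamma>. ((1 + b1) / (1 + b1 + b2)) ^ \<gamma> * real (hgrowth V E \<gamma>))"
    and sat: "summable (\<lambda>\<gamma>. (1 / (1 + b1)) ^ \<gamma> * real (hgrowth V E \<gamma>))"
  obtains x c \<kappa> where "0 \<le> x" "x \<le> 1" "0 < c" "0 \<le> \<kappa>"
    and "Delta V E * \<kappa> / (4 * \<mu>) + 1 / (8 * const_atil V E b1) = 1 - c"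
    and "E \<noteq> {} \<Longrightarrow> lS * (1 - x)\<^sup>2 \<le> \<kappa> * x"
    and "\<And>u w d. u \<in> V \<Longrightarrow> w \<in> V \<Longrightarrow> gdist V E u w = enat d \<Longrightarrow>
      x ^ d \<le> 4 * (const_a V E b1 b2)\<^sup>2 * c * rhoS V E \<mu> lS b1 b2 ^ d"
proof -
  let ?a = "const_a V E b1 b2" and ?a' = "const_atil V E b1" and ?\<gamma> = "gammaS V E \<mu> lS"
    and ?\<Delta> = "Delta V E" and ?\<rho> = "rhoS V E \<mu> lS b1 b2"
  obtain D where D: "\<And>u w d. u \<in> V \<Longrightarrow> w \<in> V \<Longrightarrow> gdist V E u w = enat d \<Longrightarrow> d \<le> D"
    and h: "\<And>\<gamma>. \<gamma> \<le> D \<Longrightarrow> 1 \<le> hgrowth V E \<gamma>" and D1: "E \<noteq> {} \<Longrightarrow> 1 \<le> D"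
    by (rule finite_diameter[OF G v]) blast
  note \<gamma> = gammaS_critical[OF mu lS, of V E]
  have \<rho>: "0 \<le> ?\<rho>" using b \<gamma>(2) by (simp add: rhoS_def)
  show thesis
  proof (cases "?\<Delta> * lS = 0")
    \<comment> \<open>Without spatial interaction \<open>?\<rho>\<close> is 0 and so is the chosen
      rate; as \<open>0 ^ 0 = 1\<close>, the weights then live on a single vertex. \<open>D\<close>
      may be 0 here, so the margin is estimated directly from \<open>1 \<le> ?a'\<close>.\<close>
    case True
    have a: "1 \<le> ?a" "1 \<le> ?a'"
      using const_a_ge[OF sa b, of 0] const_atil_ge[OF sat b(1), of 0] h[of 0] by simp_all
    show thesis
    proof (rule that[of 0 "1 - 1 / (8 * ?a')" 0])
      have "1 / (8 * ?a') \<le> 1 / 8" using a by (intro divide_left_mono) auto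
      then have c: "7 / 8 \<le> 1 - 1 / (8 * ?a')" by simp
      then show "0 < 1 - 1 / (8 * ?a')" by linarith
      have "4 * 1 * (7 / 8) \<le> 4 * ?a\<^sup>2 * (1 - 1 / (8 * ?a'))"
        using a c by (intro mult_mono) auto
      then have "1 \<le> 4 * ?a\<^sup>2 * (1 - 1 / (8 * ?a'))" by (rule order.trans[rotated]) simp
      moreover have "?\<rho> = 0" using True by (simp add: rhoS_def gammaS_def)
      ultimately show "0 ^ d \<le> 4 * ?a\<^sup>2 * (1 - 1 / (8 * ?a')) * ?\<rho> ^ d" for d
        by (cases d) auto
      show "lS * (1 - 0)\<^sup>2 \<le> 0 * 0" if "E \<noteq> {}"
        using True Delta_pos[OF G that] by simp
    qed auto
  next
    case False
    then have pos: "0 < ?\<Delta>" "0 < lS" "0 < ?\<Delta> * lS" and E: "E \<noteq> {}"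
      using lS Delta_nonneg[of V E] Delta_no_edges[of V] by (auto simp: less_le)
    \<comment> \<open>\<open>p\<close> and \<open>q\<close> are the ratios of the series
      \<open>?a'\<close> and \<open>?a\<close>, and \<open>p * q = 1 / (1 + b1 + b2)\<close> is the
      spatial share before the rate is enlarged by \<open>s\<close>.\<close>
    define p q s where "p = 1 / (1 + b1)" and "q = (1 + b1) / (1 + b1 + b2)" and "s = 1 + 1 / real D"
    \<comment> \<open>Chosen so that at \<open>x = s * ?\<rho>\<close> the critical equation for
      \<open>?\<gamma>\<close> reads
      \<open>?\<Delta> * \<kappa> * x = 4 * \<mu> * ?\<gamma>\<close>.\<close>
    define \<kappa> where "\<kappa> = 4 * \<mu> / (?\<Delta> * (s * (1 + b1 + b2)))"
    \<comment> \<open>Capping at 1 keeps the weights from growing with the distance; at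
      \<open>x = 1\<close> they are constant in space and the edges cause no loss.\<close>
    define x where "x = min 1 (s * ?\<rho>)"
    define c where "c = 1 - p * q / s - 1 / (8 * ?a')"
    have p: "0 \<le> p" "p \<le> 1" and q: "0 \<le> q" "q \<le> 1" using b by (simp_all add: p_def q_def)
    have s: "1 \<le> s" by (simp add: s_def)
    have qa: "(\<Sum>\<gamma>\<le>D. q ^ \<gamma>) \<le> ?a" and pa: "(\<Sum>\<gamma>\<le>D. p ^ \<gamma>) \<le> ?a'"
      using const_a_ge[OF sa b h, of D] const_atil_ge[OF sat b(1) h, of D] by (simp_all add: p_def q_def)
    note margin = coercivity_margin[OF p q D1[OF E] _ qa pa, folded s_def, folded c_def]
    have sB: "1 \<le> s * (1 + b1 + b2)" using s b mult_mono[of 1 s 1 "1 + b1 + b2"] by simp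
    show thesis
    proof (rule that[of x c \<kappa>])
      show x: "0 \<le> x" "x \<le> 1" using s \<rho> by (auto simp: x_def)
      show "0 < c" using margin(1)[of 0] by simp
      show "0 \<le> \<kappa>" using pos mu sB by (simp add: \<kappa>_def)
      have "?\<Delta> * \<kappa> / (4 * \<mu>) = 1 / (s * (1 + b1 + b2))"
        using pos mu by (simp add: \<kappa>_def)
      also have "\<dots> = p * q / s" using b by (simp add: p_def q_def)
      finally show "?\<Delta> * \<kappa> / (4 * \<mu>) + 1 / (8 * ?a') = 1 - c" by (simp add: c_def)
      show "lS * (1 - x)\<^sup>2 \<le> \<kappa> * x"
      proof (cases "x = 1")
        case False
        then have x_eq: "x = s * (1 + b1 + b2) * ?\<gamma>" by (auto simp: x_def rhoS_def min_def split: if_splits)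
        then have "?\<gamma> \<le> x" using sB \<gamma>(2) mult_right_mono[OF sB \<gamma>(2)] by simp
        then have "?\<Delta> * lS * (1 - x)\<^sup>2 \<le> ?\<Delta> * lS * (1 - ?\<gamma>)\<^sup>2"
          using x pos by (intro mult_left_mono power_mono) auto
        also have "\<dots> = ?\<Delta> * (\<kappa> * x)"
          using pos s b by (simp add: \<gamma>(1) x_eq \<kappa>_def)
        finally have "?\<Delta> * (lS * (1 - x)\<^sup>2) \<le> ?\<Delta> * (\<kappa> * x)" by (simp add: mult.assoc)
        then show ?thesis using pos(1) by (rule mult_left_le_imp_le)
      qed (use \<open>0 \<le> \<kappa>\<close> in simp)
      show "x ^ d \<le> 4 * ?a\<^sup>2 * c * ?\<rho> ^ d" if "u \<in> V" "w \<in> V" "gdist V E u w = enat d" for u w d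
      proof -
        have "x ^ d \<le> (s * ?\<rho>) ^ d" using x by (intro power_mono) (auto simp: x_def)
        also have "\<dots> = s ^ d * ?\<rho> ^ d" by (rule power_mult_distrib)
        also have "\<dots> \<le> 4 * ?a\<^sup>2 * c * ?\<rho> ^ d"
          using margin(2)[OF D[OF that]] \<rho> by (intro mult_right_mono) auto
        finally show ?thesis .
      qed
    qed
  qed
qed

text \<open>The two entries of the maximum in \<open>const_C\<close> are made for the temporal and
  for the spatial inequality, respectively. \<open>mu1\<close> is the statement that
  \<open>rhoT\<close> is at most 1/2, and removing a factor \<open>1 - rhoT\<close> from a
  denominator only lowers the fraction.\<close>

lemma const_C_bounds:
  assumes G: "undirected_graph V E" and v: "v \<in> V" and mu: "0 < \<mu>" and lT: "0 \<le> lT" and lS: "0 \<le> lS"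
    and b: "0 < b1" "0 < b2" and sat: "summable (\<lambda>\<gamma>. (1 / (1 + b1)) ^ \<gamma> * real (hgrowth V E \<gamma>))"
    and mu1: "8 * const_atil V E b1 * lT \<le> \<mu>"
  shows "1 \<le> const_atil V E b1" and "0 \<le> rhoT V E \<mu> lT b1" and "rhoT V E \<mu> lT b1 \<le> 1 / 2"
    and "2 * (const_a V E b1 b2)\<^sup>2 * lT \<le> \<mu> * const_C V E \<mu> lT lS b1 b2 * rhoT V E \<mu> lT b1"
    and "2 * (const_a V E b1 b2)\<^sup>2 * (Delta V E * lS) \<le> \<mu> * const_C V E \<mu> lT lS b1 b2 * rhoS V E \<mu> lS b1 b2"
    and "0 \<le> const_C V E \<mu> lT lS b1 b2"
proof -
  let ?a = "const_a V E b1 b2" and ?a' = "const_atil V E b1" and ?\<gamma> = "gammaS V E \<mu> lS"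
    and ?C = "const_C V E \<mu> lT lS b1 b2" and ?\<rho>T = "rhoT V E \<mu> lT b1" and ?\<rho>S = "rhoS V E \<mu> lS b1 b2"
  have "1 \<le> hgrowth V E 0"
    using G v gdist_refl[OF v, of E] by (intro hgrowth_pos[of V v v E 0 0]) (auto simp: undirected_graph_def zero_enat_def)
  then show a': "1 \<le> ?a'" using const_atil_ge[OF sat b(1), of 0] by simp
  show \<rho>T: "0 \<le> ?\<rho>T" "?\<rho>T \<le> 1 / 2" using a' lT mu mu1 by (simp_all add: rhoT_def field_simps)
  have C1: "?a\<^sup>2 / (2 * ?a' * (1 - ?\<rho>T)) \<le> ?C"
    and C2: "2 * ?a\<^sup>2 * Delta V E * lS / \<mu> / (?\<gamma> * (1 + b1 + b2) * (1 - ?\<rho>T)) \<le> ?C"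
    unfolding const_C_def rhoT_def by (rule max.cobounded1, rule max.cobounded2)
  have "0 \<le> ?a\<^sup>2 / (2 * ?a' * (1 - ?\<rho>T))"
    using a' \<rho>T by simp
  with C1 show C0: "0 \<le> ?C" by linarith
  have den: "0 < 1 - ?\<rho>T" "2 * ?a' * (1 - ?\<rho>T) \<le> 2 * ?a'"
    using a' \<rho>T mult_left_mono[of "1 - ?\<rho>T" 1 "2 * ?a'"] by simp_all
  have "?a\<^sup>2 / (2 * ?a') \<le> ?a\<^sup>2 / (2 * ?a' * (1 - ?\<rho>T))"
    using den a' by (intro divide_left_mono mult_pos_pos) auto
  with C1 have "?a\<^sup>2 / (2 * ?a') * ?\<rho>T \<le> ?C * ?\<rho>T" using \<rho>T by (intro mult_right_mono) auto
  moreover have "?a\<^sup>2 / (2 * ?a') * ?\<rho>T = 2 * ?a\<^sup>2 * lT / \<mu>" using a' by (simp add: rhoT_def)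
  ultimately have "\<mu> * (2 * ?a\<^sup>2 * lT / \<mu>) \<le> \<mu> * (?C * ?\<rho>T)"
    using mu by (intro mult_left_mono) auto
  then show "2 * ?a\<^sup>2 * lT \<le> \<mu> * ?C * ?\<rho>T" using mu by (simp add: mult.assoc)
  show "2 * ?a\<^sup>2 * (Delta V E * lS) \<le> \<mu> * ?C * ?\<rho>S"
  proof (cases "Delta V E * lS = 0")
    case True
    then show ?thesis by (auto simp: rhoS_def gammaS_def)
  next
    case False
    then have "0 < Delta V E * lS" using lS Delta_nonneg[of V E] by (simp add: less_le)
    then have \<gamma>: "0 < ?\<gamma>" by (rule gammaS_critical(3)[OF mu lS])
    then have \<rho>S: "0 < ?\<rho>S" using b by (simp add: rhoS_def)
    let ?n = "2 * ?a\<^sup>2 * (Delta V E * lS)"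
    have n: "0 \<le> ?n" using lS Delta_nonneg[of V E] by simp
    have "?n / \<mu> / ?\<rho>S \<le> ?n / \<mu> / (?\<rho>S * (1 - ?\<rho>T))"
      using n mu \<rho>S \<rho>T mult_left_mono[of "1 - ?\<rho>T" 1 ?\<rho>S] by (intro divide_left_mono mult_pos_pos) auto
    also have "\<dots> \<le> ?C" using C2 by (simp add: rhoS_def mult_ac)
    finally have "?n \<le> ?C * ?\<rho>S * \<mu>" using mu \<rho>S by (simp add: field_simps)
    then show ?thesis by (simp add: mult.commute mult.left_commute)
  qed
qed

text \<open>Along a coupling the distance to \<open>v0\<close> and the time lag to \<open>t0\<close>
  change by at most one. The condition on the exponents 0 and 1 passes to \<open>j\<close> and
  \<open>j + 1\<close> by the common factor \<open>x ^ (2 * j)\<close>.\<close>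

lemma power_diff_square_le:
  fixes x l \<kappa> :: real
  assumes "0 \<le> x" "0 \<le> \<kappa>" "l * (1 - x)\<^sup>2 \<le> \<kappa> * x" "m \<le> Suc n" "n \<le> Suc m"
  shows "l * (x ^ m - x ^ n)\<^sup>2 \<le> \<kappa> * (x ^ m * x ^ n)"
proof -
  have step: "l * (x ^ j - x ^ Suc j)\<^sup>2 \<le> \<kappa> * (x ^ j * x ^ Suc j)" for j
  proof -
    have "(x ^ j)\<^sup>2 * (l * (1 - x)\<^sup>2) \<le> (x ^ j)\<^sup>2 * (\<kappa> * x)"
      using assms(3) by (intro mult_left_mono) auto
    then show ?thesis by (simp add: power2_eq_square algebra_simps)
  qed
  consider "m = n" | "m = Suc n" | "n = Suc m" using assms(4,5) by linarith
  then show ?thesis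
  proof cases
    case 1
    then show ?thesis using assms by simp
  next
    case 2
    then show ?thesis using step[of n] by (simp add: power2_commute mult.commute)
  next
    case 3
    then show ?thesis using step[of m] by simp
  qed
qed

lemma sum_compose_inj_le:
  fixes h :: "'b \<Rightarrow> real"
  assumes "finite A" "finite N" "inj_on g A" "\<And>i. 0 \<le> h i" "\<And>i. i \<notin> N \<Longrightarrow> h i = 0"
  shows "(\<Sum>i\<in>A. h (g i)) \<le> (\<Sum>i\<in>N. h i)"
proof -
  have "(\<Sum>i\<in>A. h (g i)) = (\<Sum>i\<in>g ` A. h i)"
    using assms(3) by (simp add: sum.reindex)
  also have "\<dots> = (\<Sum>i\<in>g ` A \<inter> N. h i)"
    using assms by (intro sum.mono_neutral_right) auto
  also have "\<dots> \<le> (\<Sum>i\<in>N. h i)"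
    using assms by (intro sum_mono2) auto
  finally show ?thesis .
qed

subsection \<open>The local problem on a space-time neighbourhood\<close>

lemma lsmooth_const: "lsmooth l (\<lambda>x. k)" if "0 \<le> l"
  unfolding lsmooth_def using that by (intro exI[of _ "\<lambda>x. 0"]) (auto simp: zero_blinfun.rep_eq)

lemma C2_continuous_on: "C2 f \<Longrightarrow> continuous_on UNIV f"
  unfolding C2_def by (blast intro: continuous_at_imp_continuous_on has_derivative_continuous)

lemma convex_on_imp_convex_sublevel:
  assumes "convex_on UNIV f"
  shows "convex {x. f x \<le> b}"
  unfolding convex_alt
proof clarsimp
  fix x y and u :: real
  assume *: "f x \<le> b" "f y \<le> b" "0 \<le> u" "u \<le> 1"
  then have "f ((1 - u) *\<^sub>R x + u *\<^sub>R y) \<le> (1 - u) * f x + u * f y"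
    by (intro convex_onD[OF assms]) auto
  also have "\<dots> \<le> (1 - u) * b + u * b"
    using * by (intro add_mono mult_left_mono) auto
  finally show "f ((1 - u) *\<^sub>R x + u *\<^sub>R y) \<le> b" by (simp add: algebra_simps)
qed

fun term_src :: "(nat \<times> 'v \<times> 'v) + (nat \<times> 'v) \<Rightarrow> nat \<times> 'v" where
  "term_src (Inl (\<tau>, a, b)) = (\<tau>, a)"
| "term_src (Inr (\<tau>, u)) = (\<tau>, u)"

text \<open>A temporal term points back in time. For \<open>\<tau> = t\<close> its end is the node
  at time \<open>t - 1\<close> that carries the datum \<open>y\<close>; with
  \<open>1 \<le> t\<close> the natural subtraction is a genuine predecessor.\<close>

fun term_dst :: "(nat \<times> 'v \<times> 'v) + (nat \<times> 'v) \<Rightarrow> nat \<times> 'v" where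
  "term_dst (Inl (\<tau>, a, b)) = (\<tau>, b)"
| "term_dst (Inr (\<tau>, u)) = (\<tau> - 1, u)"

fun term_smoothness :: "real \<Rightarrow> real \<Rightarrow> (nat \<times> 'v \<times> 'v) + (nat \<times> 'v) \<Rightarrow> real" where
  "term_smoothness lT lS (Inl _) = lS"
| "term_smoothness lT lS (Inr _) = lT"

locale network_problem =
  fixes V :: "'v set" and E :: "('v \<times> 'v) set" and H :: nat
    and \<mu> lf lT lS :: real
    and f :: "nat \<Rightarrow> 'v \<Rightarrow> 'a::euclidean_space \<Rightarrow> real"
    and c :: "nat \<Rightarrow> 'v \<Rightarrow> 'a \<Rightarrow> 'a \<Rightarrow> real"
    and s :: "nat \<Rightarrow> ('v \<times> 'v) \<Rightarrow> 'a \<Rightarrow> 'a \<Rightarrow> real"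
    and g :: "nat \<Rightarrow> 'v \<Rightarrow> nat \<Rightarrow> 'a \<Rightarrow> real" and m :: "nat \<Rightarrow> 'v \<Rightarrow> nat"
    and t k r :: nat and v :: 'v
  assumes G: "undirected_graph V E"
    and A: "assumption_A V E H \<mu> lf lT lS f c s g m"
    and mu: "0 < \<mu>" and lT: "0 \<le> lT" and lS: "0 \<le> lS"
    and t: "1 \<le> t" and r: "1 \<le> r"
begin

definition "space_time = {t..<t + k} \<times> nbhd V E v r"
definition "edge_terms = {t..<t + k} \<times> edges_in E (splus V E (nbhd V E v (r - 1)))"
text \<open>For \<open>1 \<le> k\<close> this contains the last time slice, whose nodes are fixed
  and absent from \<open>free\<close>; hence two node sets in
  \<open>pairwise_problem\<close>.\<close>

definition "cost_nodes = {t..<t + k} \<times> nbhd V E v (r - 1)"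
definition "free = stnbhd V E t v (k - 1) (r - 1)"
definition "terms = edge_terms <+> space_time"

fun node_cost :: "nat \<times> 'v \<Rightarrow> 'a \<Rightarrow> real" where
  "node_cost (\<tau>, u) = fe H \<mu> f \<tau> u"

fun term_cost :: "(nat \<times> 'v \<times> 'v) + (nat \<times> 'v) \<Rightarrow> 'a \<times> 'a \<Rightarrow> real" where
  "term_cost (Inl (\<tau>, e)) = case_prod (se H s \<tau> e)"
| "term_cost (Inr (\<tau>, u)) = case_prod (ce H c \<tau> u)"

text \<open>With free part 0 this agrees, off \<open>free\<close>, with every assembled point,
  because \<open>local_feasible\<close> normalises to 0 there. So it can serve as the boundary
  function of \<open>feasible\<close>.\<close>

definition data :: "('v \<Rightarrow> 'a) \<Rightarrow> (nat \<Rightarrow> 'v \<Rightarrow> 'a) \<Rightarrow> nat \<times> 'v \<Rightarrow> 'a" where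
  "data y z = (\<lambda>(\<tau>, u). assemble V E t v k r y z (\<lambda>_ _. 0) \<tau> u)"

lemma finite_V: "finite V"
  using G by (simp add: undirected_graph_def)

lemma nbhd_subset: "nbhd V E w n \<subseteq> V"
  by (auto simp: nbhd_def)

lemma finite_nbhd: "finite (nbhd V E w n)"
  using finite_V nbhd_subset by (rule finite_subset[rotated])

lemma finite_E: "finite E"
  using G unfolding undirected_graph_def by (meson finite_SigmaI finite_subset)

lemma nbhd_mono: "nbhd V E v (r - 1) \<subseteq> nbhd V E v r"
  unfolding nbhd_def using order.trans[of _ "enat (r - 1)" "enat r"] by auto

lemma splus_subset: "splus V E (nbhd V E v (r - 1)) \<subseteq> nbhd V E v r"
proof
  fix u assume "u \<in> splus V E (nbhd V E v (r - 1))"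
  then consider "u \<in> nbhd V E v (r - 1)" | w where "w \<in> nbhd V E v (r - 1)" "adj E u w" "u \<in> V"
    unfolding splus_def by blast
  then show "u \<in> nbhd V E v r"
  proof cases
    case 1
    with nbhd_mono show ?thesis by blast
  next
    case 2
    then have uw: "gdist V E u w \<le> enat 1"
      using nbhd_subset[of v "r - 1"] by (intro gdist_le walk_adj) auto
    have "gdist V E w v \<le> enat (r - 1)" using 2 by (simp add: nbhd_def)
    from gdist_triangle[OF uw this] show ?thesis using r 2 by (simp add: nbhd_def)
  qed
qed

lemma edges_in_subset:
  "edges_in E (splus V E (nbhd V E v (r - 1))) \<subseteq> E"
  "edges_in E (splus V E (nbhd V E v (r - 1))) \<subseteq> nbhd V E v r \<times> nbhd V E v r"
  using splus_subset by (auto simp: edges_in_def)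

lemma finite_terms: "finite edge_terms" "finite space_time" "finite terms"
  using finite_nbhd finite_subset[OF edges_in_subset(1) finite_E]
  by (auto simp: edge_terms_def space_time_def terms_def)

lemma free_iff: "(\<tau>, u) \<in> free \<longleftrightarrow> t \<le> \<tau> \<and> \<tau> < t + (k - 1) \<and> u \<in> nbhd V E v (r - 1)"
  by (auto simp: free_def stnbhd_def)

lemma stbdry_iff:
  "(\<tau>, u) \<in> stbdry V E t v k r \<longleftrightarrow> t \<le> \<tau> \<and> \<tau> < t + k \<and> u \<in> nbhd V E v r \<and> (\<tau>, u) \<notin> free"
  by (auto simp: stbdry_def free_def stnbhd_def)

text \<open>Beyond the horizon the quadratic node cost is still \<mu>-strongly convex and the
  couplings vanish, so the same constants serve all times. \<open>1 \<le> t\<close> makes every time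
  index at least 1, where \<open>assumption_A\<close> applies up to \<open>H\<close>.\<close>

sublocale pairwise_problem cost_nodes free terms term_src term_dst node_cost term_cost
  "term_smoothness lT lS" "\<lambda>(\<tau>, u). Dom H g m \<tau> u" \<mu>
proof
  show "finite cost_nodes" by (simp add: cost_nodes_def finite_nbhd)
  show "free \<subseteq> cost_nodes" by (auto simp: free_def cost_nodes_def stnbhd_def)
  show "finite terms" by (rule finite_terms)
  show "0 < \<mu>" by (rule mu)
next
  fix i x assume "i \<in> cost_nodes"
  then obtain \<tau> u where i: "i = (\<tau>, u)" "1 \<le> \<tau>" "u \<in> V"
    using t subsetD[OF nbhd_subset] by (auto simp: cost_nodes_def)
  have "0 \<le> fe H \<mu> f \<tau> u x \<and> strongly_convex \<mu> (fe H \<mu> f \<tau> u) \<and> fe H \<mu> f \<tau> u differentiable (at x)"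
  proof (cases "\<tau> \<le> H")
    case True
    then have "fe H \<mu> f \<tau> u = f \<tau> u" by (simp add: fe_def fun_eq_iff)
    moreover have "\<tau> \<in> {1..H}" using i True by simp
    then have "0 \<le> f \<tau> u x" "strongly_convex \<mu> (f \<tau> u)" "lsmooth lf (f \<tau> u)"
      using A i(3) unfolding assumption_A_def by blast+
    moreover from this(3) have "f \<tau> u differentiable (at x)"
      unfolding lsmooth_def differentiable_def by blast
    ultimately show ?thesis by simp
  next
    case False
    then have "fe H \<mu> f \<tau> u = (\<lambda>x. \<mu> / 2 * (norm x)\<^sup>2)" by (simp add: fe_def fun_eq_iff)
    then show ?thesis
      using mu by (auto simp: strongly_convex_def convex_on_const power2_norm_eq_inner intro!: derivative_intros)
  qed
  then show "0 \<le> node_cost i x" "strongly_convex \<mu> (node_cost i)" "node_cost i differentiable (at x)"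
    by (simp_all add: i)
next
  fix p :: "(nat \<times> 'v \<times> 'v) + (nat \<times> 'v)" and x :: "'a \<times> 'a"
  assume p: "p \<in> terms"
  have "(\<forall>x. 0 \<le> term_cost p x) \<and> convex_on UNIV (term_cost p) \<and>
    lsmooth (term_smoothness lT lS p) (term_cost p)"
  proof (cases p)
    case (Inl q)
    obtain \<tau> e where q: "q = (\<tau>, e)" by (cases q)
    then have e: "e \<in> E" "1 \<le> \<tau>" using p t edges_in_subset(1) by (auto simp: Inl terms_def edge_terms_def)
    show ?thesis
    proof (cases "\<tau> \<le> H")
      case True
      then have "term_cost p = case_prod (s \<tau> e)" by (simp add: Inl q se_def fun_eq_iff)
      moreover have "\<tau> \<in> {1..H}" using e True by simp
      then have "(\<forall>x y. 0 \<le> s \<tau> e x y)" "convex_on UNIV (case_prod (s \<tau> e))" "lsmooth lS (case_prod (s \<tau> e))"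
        using A e(1) unfolding assumption_A_def by blast+
      ultimately show ?thesis by (simp add: Inl)
    next
      case False
      then have "term_cost p = (\<lambda>x. 0)" by (simp add: Inl q se_def fun_eq_iff)
      then show ?thesis using lsmooth_const[OF lS] by (simp add: Inl convex_on_const)
    qed
  next
    case (Inr q)
    obtain \<tau> u where q: "q = (\<tau>, u)" by (cases q)
    then have u: "u \<in> V" "1 \<le> \<tau>" using p t subsetD[OF nbhd_subset] by (auto simp: Inr terms_def space_time_def)
    show ?thesis
    proof (cases "\<tau> \<le> H")
      case True
      then have "term_cost p = case_prod (c \<tau> u)" by (simp add: Inr q ce_def fun_eq_iff)
      moreover have "\<tau> \<in> {1..H}" using u True by simp
      then have "(\<forall>x y. 0 \<le> c \<tau> u x y)" "convex_on UNIV (case_prod (c \<tau> u))" "lsmooth lT (case_prod (c \<tau> u))"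
        using A u(1) unfolding assumption_A_def by blast+
      ultimately show ?thesis by (simp add: Inr)
    next
      case False
      then have "term_cost p = (\<lambda>x. 0)" by (simp add: Inr q ce_def fun_eq_iff)
      then show ?thesis using lsmooth_const[OF lT] by (simp add: Inr convex_on_const)
    qed
  qed
  then show "0 \<le> term_cost p x" "convex_on UNIV (term_cost p)" "lsmooth (term_smoothness lT lS p) (term_cost p)"
    by blast+
  show "0 \<le> term_smoothness lT lS p" using lT lS by (cases p) auto
next
  fix i assume "i \<in> free"
  then obtain \<tau> u where i: "i = (\<tau>, u)" "1 \<le> \<tau>" "u \<in> V"
    using t subsetD[OF nbhd_subset] by (cases i) (auto simp: free_iff)
  have "closed (Dom H g m \<tau> u) \<and> convex (Dom H g m \<tau> u) \<and> Dom H g m \<tau> u \<noteq> {}"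
  proof (cases "\<tau> \<le> H")
    case True
    then have "\<tau> \<in> {1..H}" using i by simp
    then have "interior (Dom H g m \<tau> u) \<noteq> {}"
      and g: "\<And>j. j \<in> {1..m \<tau> u} \<Longrightarrow> convex_on UNIV (g \<tau> u j)" "\<And>j. j \<in> {1..m \<tau> u} \<Longrightarrow> C2 (g \<tau> u j)"
      using A i(3) unfolding assumption_A_def by blast+
    moreover have "Dom H g m \<tau> u = (\<Inter>j\<in>{1..m \<tau> u}. {x. g \<tau> u j x \<le> 0})"
      using True by (auto simp: Dom_def)
    ultimately show ?thesis
      using C2_continuous_on[OF g(2)] convex_on_imp_convex_sublevel[OF g(1)]
      by (auto intro!: closed_INT convex_INT closed_Collect_le)
  qed (simp add: Dom_def)
  then show "closed (case i of (\<tau>, u) \<Rightarrow> Dom H g m \<tau> u)" "convex (case i of (\<tau>, u) \<Rightarrow> Dom H g m \<tau> u)"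
    "(case i of (\<tau>, u) \<Rightarrow> Dom H g m \<tau> u) \<noteq> {}"
    by (simp_all add: i)
qed

section \<open>Identification of \<open>psi\<close> with the abstract minimizer\<close>

lemma F_eq_local_obj: "F (\<lambda>(\<tau>, u). w \<tau> u) = local_obj V E H \<mu> f c s t v k r w"
proof -
  have "(\<Sum>i\<in>cost_nodes. node_cost i (case i of (\<tau>, u) \<Rightarrow> w \<tau> u))
      = (\<Sum>\<tau>\<in>{t..<t + k}. \<Sum>u\<in>nbhd V E v (r - 1). fe H \<mu> f \<tau> u (w \<tau> u))"
    unfolding cost_nodes_def sum.cartesian_product by (intro sum.cong) auto
  moreover have "(\<Sum>p\<in>edge_terms. term_cost (Inl p) (case term_src (Inl p) of (\<tau>, u) \<Rightarrow> w \<tau> u,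
        case term_dst (Inl p) of (\<tau>, u) \<Rightarrow> w \<tau> u))
      = (\<Sum>\<tau>\<in>{t..<t + k}. \<Sum>e\<in>edges_in E (splus V E (nbhd V E v (r - 1))).
          se H s \<tau> e (w \<tau> (fst e)) (w \<tau> (snd e)))"
    unfolding edge_terms_def sum.cartesian_product by (intro sum.cong) auto
  moreover have "(\<Sum>p\<in>space_time. term_cost (Inr p) (case term_src (Inr p) of (\<tau>, u) \<Rightarrow> w \<tau> u,
        case term_dst (Inr p) of (\<tau>, u) \<Rightarrow> w \<tau> u))
      = (\<Sum>\<tau>\<in>{t..<t + k}. \<Sum>u\<in>nbhd V E v r. ce H c \<tau> u (w \<tau> u) (w (\<tau> - 1) u))"
    unfolding space_time_def sum.cartesian_product by (intro sum.cong) auto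
  ultimately show ?thesis
    unfolding F_def local_obj_def
    by (simp add: terms_def sum.Plus finite_terms(1,2) sum.distrib add.assoc)
qed

lemma assemble_free: "(\<tau>, u) \<in> free \<Longrightarrow> assemble V E t v k r y z w \<tau> u = w \<tau> u"
  using t by (auto simp: assemble_def free_iff stbdry_iff)

lemma assemble_outside:
  "(\<tau>, u) \<notin> free \<Longrightarrow> w \<tau> u = 0 \<Longrightarrow> assemble V E t v k r y z w \<tau> u = data y z (\<tau>, u)"
  by (auto simp: assemble_def data_def)

lemma data_past: "u \<in> nbhd V E v r \<Longrightarrow> data y z (t - 1, u) = y u"
  by (simp add: data_def assemble_def)

lemma data_stbdry: "(\<tau>, u) \<in> stbdry V E t v k r \<Longrightarrow> data y z (\<tau>, u) = z \<tau> u"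
  using t by (auto simp: data_def assemble_def stbdry_iff)

lemma local_feasible_iff:
  "local_feasible V E H g m t v k r w \<longleftrightarrow>
    (\<forall>\<tau> u. (\<tau>, u) \<in> free \<longrightarrow> w \<tau> u \<in> Dom H g m \<tau> u) \<and> (\<forall>\<tau> u. (\<tau>, u) \<notin> free \<longrightarrow> w \<tau> u = 0)"
  by (simp only: local_feasible_def free_def)

text \<open>Through \<open>assemble\<close>, zero-normalised free parts correspond one to one to
  points feasible for \<open>data y z\<close>; uniqueness of the minimizer then makes the definite
  description in \<open>psi\<close> denote its free part.\<close>

lemma psi_minimizer:
  obtains x where "minimizer (data y z) x"
    and "\<And>\<tau> u. (\<tau>, u) \<in> free \<Longrightarrow> psi V E H \<mu> f c s g m t v k r y z \<tau> u = x (\<tau>, u)"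
proof -
  obtain x where x: "minimizer (data y z) x" using minimizer_exists by blast
  let ?asm = "assemble V E t v k r y z"
  let ?feas = "local_feasible V E H g m t v k r"
  let ?obj = "local_obj V E H \<mu> f c s t v k r"
  define w where "w \<tau> u = (if (\<tau>, u) \<in> free then x (\<tau>, u) else 0)" for \<tau> u
  have feas: "feasible (data y z) (\<lambda>(\<tau>, u). ?asm w' \<tau> u)" if "?feas w'" for w'
    using that by (auto simp: feasible_def local_feasible_iff assemble_free assemble_outside)
  have x_eq: "x = (\<lambda>(\<tau>, u). ?asm w \<tau> u)"
  proof
    fix i :: "nat \<times> 'v"
    obtain \<tau> u where "i = (\<tau>, u)" by (cases i)
    then show "x i = (case i of (\<tau>, u) \<Rightarrow> ?asm w \<tau> u)"
      using x by (cases "i \<in> free")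
        (auto simp: minimizer_def feasible_def assemble_free assemble_outside w_def)
  qed
  have w_feas: "?feas w"
    using x by (auto simp: local_feasible_iff w_def minimizer_def feasible_def)
  have "psi V E H \<mu> f c s g m t v k r y z = w"
    unfolding psi_def
  proof (rule the_equality)
    show "?feas w \<and> (\<forall>w'. ?feas w' \<longrightarrow> ?obj (?asm w) \<le> ?obj (?asm w'))"
      using w_feas x feas unfolding F_eq_local_obj[symmetric] x_eq[symmetric] minimizer_def by blast
  next
    fix w' assume w': "?feas w' \<and> (\<forall>w''. ?feas w'' \<longrightarrow> ?obj (?asm w') \<le> ?obj (?asm w''))"
    have "minimizer (data y z) (\<lambda>(\<tau>, u). ?asm w' \<tau> u)"
      unfolding minimizer_def
    proof (intro conjI allI impI feas)
      fix x'' assume "feasible (data y z) x''"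
      have "F (\<lambda>(\<tau>, u). ?asm w' \<tau> u) \<le> F x"
        using w' w_feas unfolding F_eq_local_obj x_eq by blast
      also have "\<dots> \<le> F x''" using x \<open>feasible (data y z) x''\<close> by (simp add: minimizer_def)
      finally show "F (\<lambda>(\<tau>, u). ?asm w' \<tau> u) \<le> F x''" .
    qed (use w' in blast)
    then have eq: "(\<lambda>(\<tau>, u). ?asm w' \<tau> u) = x" using x by (rule minimizer_unique)
    show "w' = w"
    proof (intro ext)
      fix \<tau> u
      show "w' \<tau> u = w \<tau> u"
        using fun_cong[OF eq, of "(\<tau>, u)"] w' assemble_free[of \<tau> u y z w']
        by (cases "(\<tau>, u) \<in> free") (auto simp: w_def local_feasible_iff)
    qed
  qed
  then have "psi V E H \<mu> f c s g m t v k r y z \<tau> u = x (\<tau>, u)" if "(\<tau>, u) \<in> free" for \<tau> u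
    using that by (simp add: w_def)
  with x that show thesis by blast
qed

text \<open>Both vertices are joined to \<open>v\<close>, so inside the window
  \<open>the_enat\<close> is never applied to an infinite distance.\<close>

lemma gdist_nbhd:
  assumes "v0 \<in> nbhd V E v (r - 1)" "u \<in> nbhd V E v r"
  shows "gdist V E v0 u = enat (the_enat (gdist V E v0 u))"
proof -
  have "gdist V E v0 v \<le> enat (r - 1)" "gdist V E v u \<le> enat r"
    using assms by (simp_all add: nbhd_def gdist_sym[of V E v])
  from gdist_triangle[OF this] show ?thesis
    by (cases "gdist V E v0 u") auto
qed

lemma gdist_edge_le:
  assumes "v0 \<in> nbhd V E v (r - 1)" "a \<in> nbhd V E v r" "b \<in> nbhd V E v r" "adj E a b"
  shows "the_enat (gdist V E v0 b) \<le> Suc (the_enat (gdist V E v0 a))"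
  using gdist_adj[OF subsetD[OF nbhd_subset assms(2)] subsetD[OF nbhd_subset assms(3)] assms(4)
      gdist_nbhd[OF assms(1,2)]] gdist_nbhd[OF assms(1,3)]
  by (metis enat_ord_simps(1))

text \<open>In \<open>coercive\<close>, an edge term charges \<open>\<kappa>S / 4\<close> to each
  end and at most \<open>Delta V E\<close> edges meet a node; a temporal term charges
  \<open>\<kappa>T / 4\<close> to each end and at most two meet a node. \<open>T_const\<close> and
  \<open>S_const\<close> convert the working rate \<open>x\<close> into \<open>\<rho>S\<close>. The
  exponent in \<open>S_const\<close> drops by one since the free end of a boundary edge may be one
  step nearer to \<open>v0\<close> than the fixed end.\<close>

lemma psi_perturbation_bound:
  fixes y y' :: "'v \<Rightarrow> 'a" and z z' :: "nat \<Rightarrow> 'v \<Rightarrow> 'a" and x \<rho>T \<rho>S C \<kappa>S \<kappa>T \<eta> :: real and t0 :: nat and v0 :: 'v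
  defines "dd u \<equiv> the_enat (gdist V E v0 u)"
  assumes t0v0: "(t0, v0) \<in> free"
    and x: "0 \<le> x" "x \<le> 1" and \<rho>T: "0 \<le> \<rho>T" "\<rho>T \<le> 1" and \<rho>S: "0 \<le> \<rho>S" and C: "0 \<le> C"
    and \<eta>: "0 < \<eta>" and \<kappa>: "0 \<le> \<kappa>S" "0 \<le> \<kappa>T"
    and coercive: "Delta V E * \<kappa>S / 4 + \<kappa>T / 2 = (1 - \<eta>) * \<mu>"
    and S_rate: "E \<noteq> {} \<Longrightarrow> lS * (1 - x)\<^sup>2 \<le> \<kappa>S * x"
    and T_rate: "lT * (1 - \<rho>T)\<^sup>2 \<le> \<kappa>T * \<rho>T"
    and T_const: "\<And>u. u \<in> nbhd V E v r \<Longrightarrow> lT / 2 * x ^ dd u \<le> \<eta> * \<mu> * C * \<rho>T * \<rho>S ^ dd u"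
    and S_const: "\<And>u d. u \<in> nbhd V E v r \<Longrightarrow> dd u = Suc d \<Longrightarrow>
      Delta V E * (lS / 2) * x ^ d \<le> \<eta> * \<mu> * C * \<rho>S ^ dd u"
  shows "norm (psi V E H \<mu> f c s g m t v k r y z t0 v0 - psi V E H \<mu> f c s g m t v k r y' z' t0 v0)
     \<le> C * (\<Sum>(\<tau>, u)\<in>stbdry V E t v k r. \<rho>T ^ nat \<bar>int t0 - int \<tau>\<bar> * \<rho>S ^ dd u * norm (z \<tau> u - z' \<tau> u))
       + C * (\<Sum>u\<in>nbhd V E v r. \<rho>T ^ (t0 - (t - 1)) * \<rho>S ^ dd u * norm (y u - y' u))"
proof -
  let ?N = "nbhd V E v r" and ?N' = "nbhd V E v (r - 1)"
  obtain X where X: "minimizer (data y z) X"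
    and psi: "\<And>\<tau> u. (\<tau>, u) \<in> free \<Longrightarrow> psi V E H \<mu> f c s g m t v k r y z \<tau> u = X (\<tau>, u)"
    using psi_minimizer by blast
  obtain X' where X': "minimizer (data y' z') X'"
    and psi': "\<And>\<tau> u. (\<tau>, u) \<in> free \<Longrightarrow> psi V E H \<mu> f c s g m t v k r y' z' \<tau> u = X' (\<tau>, u)"
    using psi_minimizer by blast
  define \<delta> where "\<delta> i = norm (X i - X' i)" for i
  \<comment> \<open>\<open>\<Theta>\<close> decays smoothly, whereas its restriction
    \<open>\<theta>\<close> to the free nodes jumps at the boundary; this jump is the source of the
    boundary terms.\<close>
  define \<Theta> where "\<Theta> i = \<rho>T ^ nat \<bar>int t0 - int (fst i)\<bar> * x ^ dd (snd i)" for i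
  define \<theta> where "\<theta> i = (if i \<in> free then \<Theta> i else 0)" for i
  define h where "h i = (\<theta> i)\<^sup>2 * (\<delta> i)\<^sup>2" for i
  define S where "S = (\<Sum>i\<in>free. h i)"
  define \<kappa> where "\<kappa> p = (case p of Inl _ \<Rightarrow> \<kappa>S | Inr _ \<Rightarrow> \<kappa>T)" for p :: "(nat \<times> 'v \<times> 'v) + (nat \<times> 'v)"
  \<comment> \<open>The loss of a term with exactly one free end, divided by the factor
    \<open>\<Theta> * \<delta>\<close> at that end, which is at most \<open>sqrt S\<close>.\<close>
  define R where "R p = term_smoothness lT lS p / 2 *
    (if term_src p \<in> free \<and> term_dst p \<notin> free then \<Theta> (term_src p) * \<delta> (term_dst p)
     else if term_src p \<notin> free \<and> term_dst p \<in> free then \<Theta> (term_dst p) * \<delta> (term_src p) else 0)" for p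
  define B where "B i = \<eta> * \<mu> * C * (\<rho>T ^ nat \<bar>int t0 - int (fst i)\<bar> * \<rho>S ^ dd (snd i) * norm (z (fst i) (snd i) - z' (fst i) (snd i)))" for i
  define Y where "Y u = \<eta> * \<mu> * C * (\<rho>T ^ (t0 - (t - 1)) * \<rho>S ^ dd u * norm (y u - y' u))" for u
  have v0: "v0 \<in> ?N'" "t \<le> t0" "t0 < t + (k - 1)" using t0v0 by (simp_all add: free_iff)
  have dd_v0: "dd v0 = 0"
    using gdist_refl[OF subsetD[OF nbhd_subset v0(1)], of E] by (simp add: dd_def zero_enat_def)
  have \<Theta>: "0 \<le> \<Theta> i" for i using \<rho>T x by (simp add: \<Theta>_def)
  have \<delta>: "0 \<le> \<delta> i" for i by (simp add: \<delta>_def)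
  have h: "0 \<le> h i" "i \<notin> free \<Longrightarrow> h i = 0" for i by (simp_all add: h_def \<theta>_def)
  have S0: "0 \<le> S" unfolding S_def by (intro sum_nonneg h)
  have le_sqrt_S: "\<Theta> i * \<delta> i \<le> sqrt S" if "i \<in> free" for i
  proof -
    have "h i \<le> S" unfolding S_def using that finite_N h by (intro member_le_sum) auto
    then show ?thesis using that by (intro real_le_rsqrt) (simp add: h_def \<theta>_def power_mult_distrib)
  qed
  have \<delta>_past: "\<delta> (t - 1, u) = norm (y u - y' u)" if "u \<in> ?N" for u
  proof -
    have "(t - 1, u) \<notin> free" using t by (auto simp: free_iff)
    then show ?thesis
      using X X' by (simp add: \<delta>_def minimizer_def feasible_def data_past[OF that, simplified])
  qed
  have \<delta>_bdry: "\<delta> (\<tau>, u) = norm (z \<tau> u - z' \<tau> u)" if "(\<tau>, u) \<in> stbdry V E t v k r" for \<tau> u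
  proof -
    have "(\<tau>, u) \<notin> free" using that by (simp add: stbdry_iff)
    then show ?thesis
      using X X' by (simp add: \<delta>_def minimizer_def feasible_def data_stbdry[OF that])
  qed
  have terms_cases: "(\<exists>\<tau> a b. p = Inl (\<tau>, a, b) \<and> \<tau> \<in> {t..<t + k} \<and> (a, b) \<in> E \<and> a \<in> ?N \<and> b \<in> ?N)
      \<or> (\<exists>\<tau> u. p = Inr (\<tau>, u) \<and> \<tau> \<in> {t..<t + k} \<and> u \<in> ?N)" if "p \<in> terms" for p
    using that edges_in_subset by (auto simp: terms_def edge_terms_def space_time_def)
  have edge_le: "dd b \<le> Suc (dd a)" "dd a \<le> Suc (dd b)" if "(a, b) \<in> E" "a \<in> ?N" "b \<in> ?N" for a b
    using that gdist_edge_le[OF v0(1)] unfolding dd_def by (auto simp: adj_def)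
  have l: "0 \<le> term_smoothness lT lS p" for p using lT lS by (cases p) auto

  have rate: "term_smoothness lT lS p * (\<Theta> (term_src p) - \<Theta> (term_dst p))\<^sup>2
      \<le> \<kappa> p * (\<Theta> (term_src p) * \<Theta> (term_dst p))"
    if p: "p \<in> terms" and "term_src p \<in> free" "term_dst p \<in> free" for p
    using terms_cases[OF p]
  proof (elim disjE exE conjE)
    fix \<tau> a b assume *: "p = Inl (\<tau>, a, b)" "(a, b) \<in> E" "a \<in> ?N" "b \<in> ?N"
    let ?w = "\<rho>T ^ nat \<bar>int t0 - int \<tau>\<bar>"
    have "lS * (x ^ dd a - x ^ dd b)\<^sup>2 \<le> \<kappa>S * (x ^ dd a * x ^ dd b)"
      using S_rate * edge_le[OF *(2-4)] x \<kappa> by (intro power_diff_square_le) auto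
    then have "?w\<^sup>2 * (lS * (x ^ dd a - x ^ dd b)\<^sup>2) \<le> ?w\<^sup>2 * (\<kappa>S * (x ^ dd a * x ^ dd b))"
      by (rule mult_left_mono) simp
    then show ?thesis
      by (simp add: * \<Theta>_def \<kappa>_def power2_eq_square algebra_simps)
  next
    fix \<tau> u assume *: "p = Inr (\<tau>, u)" "\<tau> \<in> {t..<t + k}"
    let ?w = "x ^ dd u" and ?i = "nat \<bar>int t0 - int \<tau>\<bar>" and ?j = "nat \<bar>int t0 - int (\<tau> - 1)\<bar>"
    have "lT * (\<rho>T ^ ?i - \<rho>T ^ ?j)\<^sup>2 \<le> \<kappa>T * (\<rho>T ^ ?i * \<rho>T ^ ?j)"
      using T_rate * \<rho>T \<kappa> by (intro power_diff_square_le) auto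
    then have "?w\<^sup>2 * (lT * (\<rho>T ^ ?i - \<rho>T ^ ?j)\<^sup>2) \<le> ?w\<^sup>2 * (\<kappa>T * (\<rho>T ^ ?i * \<rho>T ^ ?j))"
      by (rule mult_left_mono) simp
    then show ?thesis
      by (simp add: * \<Theta>_def \<kappa>_def power2_eq_square algebra_simps)
  qed
  have R0: "0 \<le> R p" for p
    unfolding R_def using l[of p] \<Theta> \<delta> by simp
  have terms_le: "term_smoothness lT lS p / 2 * (\<theta> (term_src p) - \<theta> (term_dst p))\<^sup>2
        * \<delta> (term_src p) * \<delta> (term_dst p)
      \<le> \<kappa> p / 4 * (h (term_src p) + h (term_dst p)) + sqrt S * R p" if p: "p \<in> terms" for p
  proof -
    let ?a = "term_src p" and ?b = "term_dst p" and ?l = "term_smoothness lT lS p"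
    have \<kappa>p: "0 \<le> \<kappa> p" using \<kappa> by (cases p) (auto simp: \<kappa>_def)
    have nn: "0 \<le> \<kappa> p / 4 * (h ?a + h ?b)" using \<kappa>p h by simp
    consider (both) "?a \<in> free" "?b \<in> free" | (src) "?a \<in> free" "?b \<notin> free"
      | (dst) "?a \<notin> free" "?b \<in> free" | (none) "?a \<notin> free" "?b \<notin> free" by blast
    then show ?thesis
    proof cases
      case both
      have "?l * (\<Theta> ?a - \<Theta> ?b)\<^sup>2 * (\<delta> ?a * \<delta> ?b / 2) \<le> \<kappa> p * (\<Theta> ?a * \<Theta> ?b) * (\<delta> ?a * \<delta> ?b / 2)"
        using rate[OF p both] \<delta> by (intro mult_right_mono) auto
      also have "\<dots> = \<kappa> p / 4 * (2 * (\<Theta> ?a * \<delta> ?a) * (\<Theta> ?b * \<delta> ?b))" by simp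
      also have "\<dots> \<le> \<kappa> p / 4 * ((\<Theta> ?a * \<delta> ?a)\<^sup>2 + (\<Theta> ?b * \<delta> ?b)\<^sup>2)"
        using \<kappa>p sum_squares_bound by (intro mult_left_mono) auto
      finally show ?thesis
        using both by (simp add: R_def h_def \<theta>_def power_mult_distrib mult_ac)
    next
      case src
      have "\<Theta> ?a * \<delta> ?a * R p \<le> sqrt S * R p"
        using le_sqrt_S[OF src(1)] R0 by (rule mult_right_mono)
      moreover have "?l / 2 * (\<theta> ?a - \<theta> ?b)\<^sup>2 * \<delta> ?a * \<delta> ?b = \<Theta> ?a * \<delta> ?a * R p"
        using src by (simp add: R_def \<theta>_def power2_eq_square mult_ac)
      ultimately show ?thesis using nn by linarith
    next
      case dst
      have "\<Theta> ?b * \<delta> ?b * R p \<le> sqrt S * R p"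
        using le_sqrt_S[OF dst(2)] R0 by (rule mult_right_mono)
      moreover have "?l / 2 * (\<theta> ?a - \<theta> ?b)\<^sup>2 * \<delta> ?a * \<delta> ?b = \<Theta> ?b * \<delta> ?b * R p"
        using dst by (simp add: R_def \<theta>_def power2_eq_square mult_ac)
      ultimately show ?thesis using nn by linarith
    next
      case none
      then show ?thesis using nn by (simp add: R_def \<theta>_def)
    qed
  qed

  have sum_terms: "(\<Sum>p\<in>terms. u p) = (\<Sum>q\<in>edge_terms. u (Inl q)) + (\<Sum>q\<in>space_time. u (Inr q))"
    for u :: "_ \<Rightarrow> real"
    unfolding terms_def using finite_terms(1,2) by (simp add: sum.Plus)
  have edge_sum: "(\<Sum>q\<in>edge_terms. w (term_src (Inl q)) + w (term_dst (Inl q))) \<le> Delta V E * (\<Sum>i\<in>space_time. w i)"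
    if w: "\<And>i. 0 \<le> w i" for w :: "nat \<times> 'v \<Rightarrow> real"
  proof -
    have "(\<Sum>q\<in>edge_terms. w (term_src (Inl q)) + w (term_dst (Inl q)))
        = (\<Sum>\<tau>\<in>{t..<t + k}. \<Sum>e\<in>edges_in E (splus V E ?N'). w (\<tau>, fst e) + w (\<tau>, snd e))"
      unfolding edge_terms_def sum.cartesian_product by (intro sum.cong) auto
    also have "\<dots> \<le> (\<Sum>\<tau>\<in>{t..<t + k}. Delta V E * (\<Sum>u\<in>?N. w (\<tau>, u)))"
      using w by (intro sum_mono sum_edge_endpoints_le[OF G edges_in_subset nbhd_subset]) auto
    also have "\<dots> = Delta V E * (\<Sum>i\<in>space_time. w i)"
      unfolding space_time_def by (simp add: sum_distrib_left sum.cartesian_product)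
    finally show ?thesis .
  qed

  have T_sum: "(\<Sum>p\<in>terms. \<kappa> p / 4 * (h (term_src p) + h (term_dst p))) \<le> (1 - \<eta>) * \<mu> * S"
  proof -
    have st: "(\<Sum>i\<in>space_time. h i) \<le> S"
      unfolding S_def using sum_compose_inj_le[OF finite_terms(2) finite_N inj_on_id2 h] by simp
    \<comment> \<open>Injectivity of \<open>\<tau> - 1\<close> on natural numbers holds since every
      \<open>\<tau>\<close> here is at least \<open>t \<ge> 1\<close>.\<close>
    have "inj_on (\<lambda>q. term_dst (Inr q)) space_time"
      using t by (force simp: inj_on_def space_time_def)
    then have dst: "(\<Sum>q\<in>space_time. h (term_dst (Inr q))) \<le> S"
      unfolding S_def by (intro sum_compose_inj_le finite_terms finite_N h)
    have "term_src (Inr q) = q" for q :: "nat \<times> 'v" by (cases q) simp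
    then have src: "(\<Sum>q\<in>space_time. h (term_src (Inr q))) \<le> S" using st by simp
    have "(\<Sum>q\<in>edge_terms. \<kappa>S / 4 * (h (term_src (Inl q)) + h (term_dst (Inl q))))
        \<le> \<kappa>S / 4 * (Delta V E * S)"
      unfolding sum_distrib_left[symmetric]
      using order.trans[OF edge_sum[of h, OF h(1)]] mult_left_mono[OF st Delta_nonneg[of V E]] \<kappa>(1)
      by (intro mult_left_mono) auto
    moreover have "(\<Sum>q\<in>space_time. \<kappa>T / 4 * (h (term_src (Inr q)) + h (term_dst (Inr q)))) \<le> \<kappa>T / 4 * (S + S)"
      unfolding sum_distrib_left[symmetric] sum.distrib
      using src dst \<kappa>(2) by (intro mult_left_mono add_mono) auto
    ultimately have "(\<Sum>p\<in>terms. \<kappa> p / 4 * (h (term_src p) + h (term_dst p)))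
        \<le> \<kappa>S / 4 * (Delta V E * S) + \<kappa>T / 4 * (S + S)"
      unfolding sum_terms by (simp add: \<kappa>_def)
    also have "\<dots> = (Delta V E * \<kappa>S / 4 + \<kappa>T / 2) * S" by (simp add: algebra_simps)
    finally show ?thesis unfolding coercive .
  qed

  \<comment> \<open>The split prevents double charges: an edge leaves the free set through a vertex
    outside \<open>?N'\<close>, whereas a temporal term leads from a free node forward to a fixed
    one only above a vertex of \<open>?N'\<close>, in the last slice.\<close>
  define Bs where "Bs i = (if i \<in> stbdry V E t v k r \<and> snd i \<notin> ?N' then B i else 0)" for i
  define Bt where "Bt i = (if i \<in> stbdry V E t v k r \<and> snd i \<in> ?N' then B i else 0)" for i
  have B0: "0 \<le> B i" for i
    unfolding B_def using \<eta> mu C \<rho>T \<rho>S by simp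
  have Y0: "0 \<le> Y u" for u
    unfolding Y_def using \<eta> mu C \<rho>T \<rho>S by simp
  have Bs0: "0 \<le> Bs i" and Bt0: "0 \<le> Bt i" for i
    using B0 by (simp_all add: Bs_def Bt_def)
  have spatial: "Delta V E * (lS / 2 * (\<Theta> (\<tau>, a) * \<delta> (\<tau>, b))) \<le> Bs (\<tau>, b)"
    if "(\<tau>, a) \<in> free" "(\<tau>, b) \<notin> free" "b \<in> ?N" "a \<in> ?N" "dd b \<le> Suc (dd a)" for \<tau> a b
  proof -
    have bd: "(\<tau>, b) \<in> stbdry V E t v k r" "b \<notin> ?N'"
      using that by (auto simp: stbdry_iff free_iff)
    then have "b \<noteq> v0" using v0 by blast
    have "dd b \<noteq> 0"
    proof
      assume "dd b = 0"
      then have "gdist V E v0 b = enat 0" using gdist_nbhd[OF v0(1) that(3)] by (simp add: dd_def)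
      from walk_gdist[OF this] \<open>b \<noteq> v0\<close> show False by (auto simp: walk_def)
    qed
    then obtain d where d: "dd b = Suc d" by (cases "dd b") auto
    let ?w = "\<rho>T ^ nat \<bar>int t0 - int \<tau>\<bar>"
    have "x ^ dd a \<le> x ^ d" using d that(5) x by (intro power_decreasing) auto
    then have "Delta V E * (lS / 2) * x ^ dd a \<le> Delta V E * (lS / 2) * x ^ d"
      using Delta_nonneg[of V E] lS by (intro mult_left_mono) auto
    also have "\<dots> \<le> \<eta> * \<mu> * C * \<rho>S ^ dd b" by (rule S_const[OF that(3) d])
    finally have "(Delta V E * (lS / 2) * x ^ dd a) * (?w * \<delta> (\<tau>, b)) \<le> (\<eta> * \<mu> * C * \<rho>S ^ dd b) * (?w * \<delta> (\<tau>, b))"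
      using \<rho>T \<delta> by (intro mult_right_mono) auto
    then show ?thesis
      using bd by (simp add: Bs_def B_def \<Theta>_def \<delta>_bdry mult_ac)
  qed
  \<comment> \<open>A fixed node may meet \<open>Delta V E\<close> edges. Each edge therefore claims
    only the fraction \<open>1 / Delta V E\<close> of \<open>Bs\<close> at its ends, and
    \<open>edge_sum\<close> gives the factor back.\<close>
  have edge_R: "Delta V E * R (Inl q) \<le> Bs (term_src (Inl q)) + Bs (term_dst (Inl q))" if "q \<in> edge_terms" for q
  proof -
    have "Inl q \<in> terms" using that by (auto simp: terms_def)
    from terms_cases[OF this] obtain \<tau> a b where
      q: "q = (\<tau>, a, b)" "(a, b) \<in> E" "a \<in> ?N" "b \<in> ?N" by auto
    show ?thesis
      using spatial[of \<tau> a b] spatial[of \<tau> b a] edge_le[OF q(2-4)] q Bs0[of "(\<tau>, a)"] Bs0[of "(\<tau>, b)"]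
      by (auto simp: R_def intro: add_increasing add_increasing2)
  qed
  have edge_R_sum: "(\<Sum>q\<in>edge_terms. R (Inl q)) \<le> (\<Sum>i\<in>space_time. Bs i)"
  proof (cases "E = {}")
    case True
    then have "edge_terms = {}" unfolding edge_terms_def using edges_in_subset(1) by blast
    then show ?thesis using Bs0 by (simp add: sum_nonneg)
  next
    case False
    have "Delta V E * (\<Sum>q\<in>edge_terms. R (Inl q)) \<le> (\<Sum>q\<in>edge_terms. Bs (term_src (Inl q)) + Bs (term_dst (Inl q)))"
      unfolding sum_distrib_left by (intro sum_mono edge_R)
    also have "\<dots> \<le> Delta V E * (\<Sum>i\<in>space_time. Bs i)" by (rule edge_sum[of Bs, OF Bs0])
    finally show ?thesis using Delta_pos[OF G False] by (rule mult_left_le_imp_le)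
  qed
  have time_R: "R (Inr q) \<le> Bt q + (if fst q = t then Y (snd q) else 0)" if "q \<in> space_time" for q
  proof -
    obtain \<tau> u where q: "q = (\<tau>, u)" "t \<le> \<tau>" "\<tau> < t + k" "u \<in> ?N"
      using \<open>q \<in> space_time\<close> by (auto simp: space_time_def)
    consider (past) "(\<tau>, u) \<in> free" "(\<tau> - 1, u) \<notin> free" | (future) "(\<tau>, u) \<notin> free" "(\<tau> - 1, u) \<in> free"
      | (zero) "R (Inr q) = 0"
      by (cases "(\<tau>, u) \<in> free"; cases "(\<tau> - 1, u) \<in> free") (simp_all add: R_def q)
    then show ?thesis
    proof cases
      case past
      then have \<tau>: "\<tau> = t" by (auto simp: free_iff)
      \<comment> \<open>The fixed node lies one step further from \<open>t0\<close> than the free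
        one; \<open>T_const\<close> supplies the additional factor \<open>\<rho>T\<close>. The same
        happens at the last slice.\<close>
      have e: "t0 - (t - 1) = Suc (nat \<bar>int t0 - int t\<bar>)" using v0 t by auto
      have "(lT / 2 * x ^ dd u) * (\<rho>T ^ nat \<bar>int t0 - int t\<bar> * norm (y u - y' u))
          \<le> (\<eta> * \<mu> * C * \<rho>T * \<rho>S ^ dd u) * (\<rho>T ^ nat \<bar>int t0 - int t\<bar> * norm (y u - y' u))"
        using T_const[OF q(4)] \<rho>T by (intro mult_right_mono) auto
      then have "R (Inr q) \<le> Y u"
        using past by (simp add: R_def q \<tau> Y_def e[unfolded One_nat_def] \<Theta>_def
            \<delta>_past[OF q(4), unfolded One_nat_def] mult_ac)
      then show ?thesis using Bt0[of q] by (simp add: q \<tau>)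
    next
      case future
      then have \<tau>: "t \<le> \<tau> - 1" "\<tau> = t + (k - 1)" "u \<in> ?N'" using q by (auto simp: free_iff)
      then have bd: "(\<tau>, u) \<in> stbdry V E t v k r" using q future by (auto simp: stbdry_iff)
      have e: "nat \<bar>int t0 - int \<tau>\<bar> = Suc (nat \<bar>int t0 - int (\<tau> - 1)\<bar>)" using v0 \<tau> t by auto
      have "(lT / 2 * x ^ dd u) * (\<rho>T ^ nat \<bar>int t0 - int (\<tau> - 1)\<bar> * norm (z \<tau> u - z' \<tau> u))
          \<le> (\<eta> * \<mu> * C * \<rho>T * \<rho>S ^ dd u) * (\<rho>T ^ nat \<bar>int t0 - int (\<tau> - 1)\<bar> * norm (z \<tau> u - z' \<tau> u))"
        using T_const[OF q(4)] \<rho>T by (intro mult_right_mono) auto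
      moreover have "R (Inr q) = (lT / 2 * x ^ dd u) * (\<rho>T ^ nat \<bar>int t0 - int (\<tau> - 1)\<bar> * norm (z \<tau> u - z' \<tau> u))"
        using future by (simp add: R_def q \<Theta>_def \<delta>_bdry[OF bd] mult_ac)
      moreover have "Bt q = (\<eta> * \<mu> * C * \<rho>T * \<rho>S ^ dd u) * (\<rho>T ^ nat \<bar>int t0 - int (\<tau> - 1)\<bar> * norm (z \<tau> u - z' \<tau> u))"
        using bd \<tau>(3) by (simp add: Bt_def B_def q e[unfolded One_nat_def] mult_ac)
      ultimately show ?thesis using Y0[of "snd q"] by simp
    next
      case zero
      then show ?thesis using Bt0[of q] Y0[of "snd q"] by simp
    qed
  qed
  have "(\<Sum>p\<in>terms. R p) \<le> (\<Sum>i\<in>space_time. Bs i) + (\<Sum>i\<in>space_time. Bt i + (if fst i = t then Y (snd i) else 0))"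
    unfolding sum_terms by (intro add_mono edge_R_sum sum_mono time_R)
  also have "\<dots> = (\<Sum>i\<in>space_time. Bs i + Bt i) + (\<Sum>i\<in>space_time. if fst i = t then Y (snd i) else 0)"
    by (simp add: sum.distrib)
  also have "(\<Sum>i\<in>space_time. Bs i + Bt i) = (\<Sum>i\<in>stbdry V E t v k r. B i)"
    using finite_terms(2)
    by (intro sum.mono_neutral_cong_right) (auto simp: Bs_def Bt_def stbdry_iff space_time_def)
  also have "(\<Sum>i\<in>space_time. if fst i = t then Y (snd i) else 0) = (\<Sum>u\<in>?N. Y u)"
  proof -
    have "(\<Sum>i\<in>space_time. if fst i = t then Y (snd i) else 0)
        = (\<Sum>\<tau>\<in>{t..<t + k}. \<Sum>u\<in>?N. if \<tau> = t then Y u else 0)"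
      unfolding space_time_def sum.cartesian_product by (intro sum.cong) auto
    also have "\<dots> = (\<Sum>\<tau>\<in>{t..<t + k}. if \<tau> = t then (\<Sum>u\<in>?N. Y u) else 0)"
      by (intro sum.cong) auto
    also have "\<dots> = (\<Sum>u\<in>?N. Y u)" using v0 by (simp add: sum.delta')
    finally show ?thesis .
  qed
  finally have R_sum: "(\<Sum>p\<in>terms. R p) \<le> (\<Sum>i\<in>stbdry V E t v k r. B i) + (\<Sum>u\<in>?N. Y u)" .

  have S_le: "\<eta> * \<mu> * sqrt S \<le> (\<Sum>p\<in>terms. R p)"
  proof (rule weighted_perturbation_bound[OF X X'])
    show "\<theta> i = 0" if "i \<notin> free" for i using that by (simp add: \<theta>_def)
    show "S = (\<Sum>i\<in>free. (\<theta> i)\<^sup>2 * (norm (X i - X' i))\<^sup>2)" by (simp add: S_def h_def \<delta>_def)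
    show "(\<Sum>p\<in>terms. \<kappa> p / 4 * (h (term_src p) + h (term_dst p))) \<le> (1 - \<eta>) * \<mu> * S" by (rule T_sum)
    show "0 \<le> R p" for p by (rule R0)
    show "term_smoothness lT lS p / 2 * (\<theta> (term_src p) - \<theta> (term_dst p))\<^sup>2
          * norm (X (term_src p) - X' (term_src p)) * norm (X (term_dst p) - X' (term_dst p))
        \<le> \<kappa> p / 4 * (h (term_src p) + h (term_dst p)) + sqrt S * R p" if "p \<in> terms" for p
      using terms_le[OF that] unfolding \<delta>_def .
  qed
  let ?rhs = "C * (\<Sum>(\<tau>, u)\<in>stbdry V E t v k r. \<rho>T ^ nat \<bar>int t0 - int \<tau>\<bar> * \<rho>S ^ dd u * norm (z \<tau> u - z' \<tau> u))
       + C * (\<Sum>u\<in>?N. \<rho>T ^ (t0 - (t - 1)) * \<rho>S ^ dd u * norm (y u - y' u))"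
  have rhs: "(\<Sum>i\<in>stbdry V E t v k r. B i) + (\<Sum>u\<in>?N. Y u) = \<eta> * \<mu> * ?rhs"
    by (simp only: B_def Y_def sum_distrib_left[symmetric] split_def distrib_left mult.assoc)
  have "\<eta> * \<mu> * sqrt S \<le> \<eta> * \<mu> * ?rhs"
    using order.trans[OF S_le R_sum] unfolding rhs .
  moreover have "0 < \<eta> * \<mu>" using \<eta> mu by (rule mult_pos_pos)
  ultimately have main: "sqrt S \<le> ?rhs" by (rule mult_left_le_imp_le)
  \<comment> \<open>The weight of the target node is 1, both of its exponents being 0.\<close>
  have "\<delta> (t0, v0) \<le> sqrt S"
    using le_sqrt_S[OF t0v0] by (simp add: \<Theta>_def dd_v0)
  with main show ?thesis
    unfolding psi[OF t0v0] psi'[OF t0v0] \<delta>_def by linarith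
qed

end

theorem theorem3p3:
  fixes V :: "'v set" and E :: "('v \<times> 'v) set" and H :: nat
    and \<mu> lf lT lS b1 b2 :: real
    and f :: "nat \<Rightarrow> 'v \<Rightarrow> 'a::euclidean_space \<Rightarrow> real"
    and c :: "nat \<Rightarrow> 'v \<Rightarrow> 'a \<Rightarrow> 'a \<Rightarrow> real"
    and s :: "nat \<Rightarrow> ('v \<times> 'v) \<Rightarrow> 'a \<Rightarrow> 'a \<Rightarrow> real"
    and g :: "nat \<Rightarrow> 'v \<Rightarrow> nat \<Rightarrow> 'a \<Rightarrow> real" and m :: "nat \<Rightarrow> 'v \<Rightarrow> nat"
    and t k r t0 :: nat and v v0 :: 'v
    and y y' :: "'v \<Rightarrow> 'a" and z z' :: "nat \<Rightarrow> 'v \<Rightarrow> 'a"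
  assumes G: "undirected_graph V E"
    and A: "assumption_A V E H \<mu> lf lT lS f c s g m"
    and mu: "\<mu> > 0" and lf: "0 \<le> lf" and lT: "0 \<le> lT" and lS: "0 \<le> lS"
    and b1: "b1 > 0" and b2: "b2 > 0"
    and sa: "summable (\<lambda>\<gamma>. ((1 + b1) / (1 + b1 + b2)) ^ \<gamma> * real (hgrowth V E \<gamma>))"
    and sat: "summable (\<lambda>\<gamma>. (1 / (1 + b1)) ^ \<gamma> * real (hgrowth V E \<gamma>))"
    and mu1: "\<mu> \<ge> 8 * const_atil V E b1 * lT"
    and mu2: "\<mu> \<ge> Delta V E * lS * (b1 + b2) / 4"
    and t: "t \<ge> 1" and v: "v \<in> V" and k: "k \<ge> 1" and r: "r \<ge> 1"
    and t0v0: "(t0, v0) \<in> stnbhd V E t v (k - 1) (r - 1)"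
  shows "norm (psi V E H \<mu> f c s g m t v k r y z t0 v0 - psi V E H \<mu> f c s g m t v k r y' z' t0 v0)
     \<le> const_C V E \<mu> lT lS b1 b2 * (\<Sum>(\<tau>, u)\<in>stbdry V E t v k r.
              rhoT V E \<mu> lT b1 ^ nat \<bar>int t0 - int \<tau>\<bar> * rhoS V E \<mu> lS b1 b2 ^ the_enat (gdist V E v0 u)
              * norm (z \<tau> u - z' \<tau> u))
       + const_C V E \<mu> lT lS b1 b2 * (\<Sum>u\<in>nbhd V E v r.
              rhoT V E \<mu> lT b1 ^ (t0 - (t - 1)) * rhoS V E \<mu> lS b1 b2 ^ the_enat (gdist V E v0 u)
              * norm (y u - y' u))"
proof -
  interpret network_problem V E H \<mu> lf lT lS f c s g m t k r v
    by unfold_locales (fact G A mu lT lS t r)+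
  let ?a = "const_a V E b1 b2" and ?a' = "const_atil V E b1" and ?C = "const_C V E \<mu> lT lS b1 b2"
    and ?\<rho>T = "rhoT V E \<mu> lT b1" and ?\<rho>S = "rhoS V E \<mu> lS b1 b2" and ?\<Delta> = "Delta V E"
    and ?dd = "\<lambda>u. the_enat (gdist V E v0 u)"
  note C = const_C_bounds[OF G v mu lT lS b1 b2 sat mu1]
  obtain x \<eta> \<kappa> where x: "0 \<le> x" "x \<le> 1" and \<eta>: "0 < \<eta>" and \<kappa>: "0 \<le> \<kappa>"
    and coercive: "?\<Delta> * \<kappa> / (4 * \<mu>) + 1 / (8 * ?a') = 1 - \<eta>"
    and S_rate: "E \<noteq> {} \<Longrightarrow> lS * (1 - x)\<^sup>2 \<le> \<kappa> * x"
    and x_pow: "\<And>u w d. u \<in> V \<Longrightarrow> w \<in> V \<Longrightarrow> gdist V E u w = enat d \<Longrightarrow> x ^ d \<le> 4 * ?a\<^sup>2 * \<eta> * ?\<rho>S ^ d"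
    by (rule decay_parameters[OF G v mu lS b1 b2 sa sat]) blast
  have \<rho>S: "0 \<le> ?\<rho>S" using b1 b2 gammaS_critical(2)[OF mu lS, of V E] by (simp add: rhoS_def)
  have free: "(t0, v0) \<in> free" using t0v0 by (simp add: free_def)
  then have v0: "v0 \<in> nbhd V E v (r - 1)" by (simp add: free_iff)
  show ?thesis
  \<comment> \<open>This \<open>\<kappa>T\<close> satisfies
    \<open>\<kappa>T * ?\<rho>T = lT\<close>, so the temporal rate condition reduces to
    \<open>(1 - ?\<rho>T)\<^sup>2 \<le> 1\<close>; half of it is the share
    \<open>1 / (8 * ?a')\<close> of \<mu> reserved in \<open>coercive\<close>.\<close>
  proof (rule psi_perturbation_bound[OF free x C(2) _ \<rho>S C(6) \<eta> \<kappa>, where \<kappa>T = "\<mu> / (4 * ?a')"])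
    show "?\<rho>T \<le> 1" using C(3) by simp
    show "0 \<le> \<mu> / (4 * ?a')" using mu C(1) by simp
    have "?\<Delta> * \<kappa> / 4 + \<mu> / (4 * ?a') / 2 = \<mu> * (?\<Delta> * \<kappa> / (4 * \<mu>) + 1 / (8 * ?a'))"
      using mu by (simp add: distrib_left)
    then show "?\<Delta> * \<kappa> / 4 + \<mu> / (4 * ?a') / 2 = (1 - \<eta>) * \<mu>" by (simp add: coercive)
    show "lS * (1 - x)\<^sup>2 \<le> \<kappa> * x" if "E \<noteq> {}" using that by (rule S_rate)
    have "lT * (1 - ?\<rho>T)\<^sup>2 \<le> lT * 1"
      using lT C(2,3) by (intro mult_left_mono power_le_one) auto
    also have "\<dots> = \<mu> / (4 * ?a') * ?\<rho>T" using mu C(1) by (simp add: rhoT_def)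
    finally show "lT * (1 - ?\<rho>T)\<^sup>2 \<le> \<mu> / (4 * ?a') * ?\<rho>T" .
  next
    fix u assume u: "u \<in> nbhd V E v r"
    have "lT / 2 * x ^ ?dd u \<le> lT / 2 * (4 * ?a\<^sup>2 * \<eta> * ?\<rho>S ^ ?dd u)"
      using lT x_pow[OF subsetD[OF nbhd_subset v0] subsetD[OF nbhd_subset u] gdist_nbhd[OF v0 u]]
      by (intro mult_left_mono) auto
    also have "\<dots> = (\<eta> * ?\<rho>S ^ ?dd u) * (2 * ?a\<^sup>2 * lT)" by simp
    also have "\<dots> \<le> (\<eta> * ?\<rho>S ^ ?dd u) * (\<mu> * ?C * ?\<rho>T)"
      using \<eta> \<rho>S C(4) by (intro mult_left_mono) auto
    finally show "lT / 2 * x ^ ?dd u \<le> \<eta> * \<mu> * ?C * ?\<rho>T * ?\<rho>S ^ ?dd u" by (simp add: mult_ac)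
  next
    fix u d assume u: "u \<in> nbhd V E v r" and d: "?dd u = Suc d"
    \<comment> \<open>\<open>x_pow\<close> speaks only about exponents that occur as distances; the
      predecessor \<open>d\<close> of a distance is one, by an intermediate vertex.\<close>
    obtain w where w: "w \<in> V" "gdist V E v0 w = enat d"
      using gdist_intermediate[OF gdist_nbhd[OF v0 u], of d] d nbhd_subset u by auto
    have "?\<Delta> * (lS / 2) * x ^ d \<le> ?\<Delta> * (lS / 2) * (4 * ?a\<^sup>2 * \<eta> * ?\<rho>S ^ d)"
      using lS Delta_nonneg[of V E] x_pow[OF subsetD[OF nbhd_subset v0] w] by (intro mult_left_mono) auto
    also have "\<dots> = (\<eta> * ?\<rho>S ^ d) * (2 * ?a\<^sup>2 * (?\<Delta> * lS))" by simp
    also have "\<dots> \<le> (\<eta> * ?\<rho>S ^ d) * (\<mu> * ?C * ?\<rho>S)"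
      using \<eta> \<rho>S C(5) by (intro mult_left_mono) auto
    finally show "?\<Delta> * (lS / 2) * x ^ d \<le> \<eta> * \<mu> * ?C * ?\<rho>S ^ ?dd u" by (simp add: d mult_ac)
  qed
qed

end
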